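(* Let $F$ be a field of characteristic $0$ and let $A$ be an indecomposable generalized Cartan matrix (not necessarily symmetrizable). Then $$\operatorname{Der}(\mathfrak b^+)=\operatorname{Hom}(\mathfrak h,\mathfrak c)\oplus\operatorname{ad}(\mathfrak b^+)\qquad\text{and}\qquad \operatorname{Der}(\tilde{\mathfrak b}^+)=\operatorname{Hom}(\mathfrak h,\mathfrak c)\oplus\operatorname{ad}(\tilde{\mathfrak b}^+).$$
   Context: $F$ is a field of characteristic $0$. A generalized Cartan matrix is an integer matrix $A=(a_{ij})_{i,j\in I}$, $I=\{0,1,\dots,l\}$, with $a_{ii}=2$, $a_{ij}\le 0$ for $i\neq j$, and $a_{ij}=0$ iff $a_{ji}=0$. Let $(\mathfrak h,\Pi,\Pi^\vee)$ be a realization of $A$ over $F$: $\dim\mathfrak h=2(l+1)-\operatorname{rank}A$, and $\Pi=\{\alpha_0,\dots,\alpha_l\}\subset\mathfrak h^*$, $\Pi^\vee=\{\alpha_0^\vee,\dots,\alpha_l^\vee\}\subset\mathfrak h$ are linearly independent with $\alpha_i(\alpha_j^\vee)=a_{ji}$. The contragredient Lie algebra $L(A)$ is generated by $\mathfrak h$, $e_i,f_i$ ($i\in I$) with relations $[\mathfrak h,\mathfrak h]=0$, $[e_i,f_j]=\delta_{ij}\alpha_i^\vee$, $[h,e_i]=\alpha_i(h)e_i$, $[h,f_i]=-\alpha_i(h)f_i$, and $(\operatorname{ad}e_i)^{1-a_{ij}}e_j=0=(\operatorname{ad}f_i)^{1-a_{ij}}f_j$ for $i\ne j$. $\tilde{\mathfrak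 n}^+\subset L(A)$ is the subalgebra generated by the $e_i$ and $\tilde{\mathfrak b}^+=\mathfrak h\oplus\tilde{\mathfrak n}^+$. The Kac–Moody algebra $\mathfrak g=\mathfrak g(A)$ is the quotient of $L(A)$ by its maximal ideal intersecting $\mathfrak h$ trivially; $\mathfrak n^+\subset\mathfrak g$ is the subalgebra generated by the $e_i$ and $\mathfrak b^+=\mathfrak h\oplus\mathfrak n^+$. $\mathfrak c=\{h\in\mathfrak h:\alpha_i(h)=0\ \forall i\in I\}$ is the center of $\mathfrak g$. $\operatorname{Der}$ denotes the Lie algebra of $F$-linear derivations. $\operatorname{Hom}(\mathfrak h,\mathfrak c)$, the space of $F$-linear maps $\mathfrak h\to\mathfrak c$, is regarded as a space of derivations of $\mathfrak b^+$ (resp. $\tilde{\mathfrak b}^+$) by extending each map by $0$ on $\mathfrak n^+$ (resp. $\tilde{\mathfrak n}^+$). *)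

theory Defs
  imports "HOL-Analysis.Analysis"
begin

section \<open>Lie algebras on carrier sets\<close>

record ('f, 'a) lie_struct =
  carr :: "'a set"
  add :: "'a \<Rightarrow> 'a \<Rightarrow> 'a"
  zer :: 'a
  smul :: "'f \<Rightarrow> 'a \<Rightarrow> 'a"
  brk :: "'a \<Rightarrow> 'a \<Rightarrow> 'a"

locale lie_algebra =
  fixes L :: "('f::field, 'a, 'm) lie_struct_scheme"
  assumes add_closed: "\<lbrakk>x \<in> carr L; y \<in> carr L\<rbrakk> \<Longrightarrow> add L x y \<in> carr L"
    and zer_closed: "zer L \<in> carr L"
    and smul_closed: "x \<in> carr L \<Longrightarrow> smul L c x \<in> carr L"
    and brk_closed: "\<lbrakk>x \<in> carr L; y \<in> carr L\<rbrakk> \<Longrightarrow> brk L x y \<in> carr L"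
    and add_assoc:
      "\<lbrakk>x \<in> carr L; y \<in> carr L; z \<in> carr L\<rbrakk> \<Longrightarrow> add L (add L x y) z = add L x (add L y z)"
    and add_comm: "\<lbrakk>x \<in> carr L; y \<in> carr L\<rbrakk> \<Longrightarrow> add L x y = add L y x"
    and add_zer: "x \<in> carr L \<Longrightarrow> add L x (zer L) = x"
    and add_neg: "x \<in> carr L \<Longrightarrow> add L x (smul L (-1) x) = zer L"
    and smul_add_right:
      "\<lbrakk>x \<in> carr L; y \<in> carr L\<rbrakk> \<Longrightarrow> smul L c (add L x y) = add L (smul L c x) (smul L c y)"
    and smul_add_left: "x \<in> carr L \<Longrightarrow> smul L (c + d) x = add L (smul L c x) (smul L d x)"
    and smul_smul: "x \<in> carr L \<Longrightarrow> smul L c (smul L d x) = smul L (c * d) x"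
    and smul_one: "x \<in> carr L \<Longrightarrow> smul L 1 x = x"
    and brk_add_left:
      "\<lbrakk>x \<in> carr L; y \<in> carr L; z \<in> carr L\<rbrakk> \<Longrightarrow> brk L (add L x y) z = add L (brk L x z) (brk L y z)"
    and brk_add_right:
      "\<lbrakk>x \<in> carr L; y \<in> carr L; z \<in> carr L\<rbrakk> \<Longrightarrow> brk L x (add L y z) = add L (brk L x y) (brk L x z)"
    and brk_smul_left:
      "\<lbrakk>x \<in> carr L; y \<in> carr L\<rbrakk> \<Longrightarrow> brk L (smul L c x) y = smul L c (brk L x y)"
    and brk_smul_right:
      "\<lbrakk>x \<in> carr L; y \<in> carr L\<rbrakk> \<Longrightarrow> brk L x (smul L c y) = smul L c (brk L x y)"
    and brk_self: "x \<in> carr L \<Longrightarrow> brk L x x = zer L"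
    and jacobi:
      "\<lbrakk>x \<in> carr L; y \<in> carr L; z \<in> carr L\<rbrakk> \<Longrightarrow>
        add L (brk L x (brk L y z)) (add L (brk L y (brk L z x)) (brk L z (brk L x y))) = zer L"

definition lie_subspace :: "('f, 'a, 'm) lie_struct_scheme \<Rightarrow> 'a set \<Rightarrow> bool" where
  "lie_subspace L U \<longleftrightarrow> U \<subseteq> carr L \<and> zer L \<in> U \<and>
     (\<forall>x\<in>U. \<forall>y\<in>U. add L x y \<in> U) \<and> (\<forall>c. \<forall>x\<in>U. smul L c x \<in> U)"

definition lie_subalgebra :: "('f, 'a, 'm) lie_struct_scheme \<Rightarrow> 'a set \<Rightarrow> bool" where
  "lie_subalgebra L U \<longleftrightarrow> lie_subspace L U \<and> (\<forall>x\<in>U. \<forall>y\<in>U. brk L x y \<in> U)"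

definition lie_ideal :: "('f, 'a, 'm) lie_struct_scheme \<Rightarrow> 'a set \<Rightarrow> bool" where
  "lie_ideal L J \<longleftrightarrow> lie_subspace L J \<and> (\<forall>x\<in>carr L. \<forall>y\<in>J. brk L x y \<in> J)"

definition lie_generated :: "('f, 'a, 'm) lie_struct_scheme \<Rightarrow> 'a set \<Rightarrow> 'a set" where
  "lie_generated L S = \<Inter>{U. lie_subalgebra L U \<and> S \<subseteq> U}"

definition sum_set :: "('f, 'a, 'm) lie_struct_scheme \<Rightarrow> 'a set \<Rightarrow> 'a set \<Rightarrow> 'a set" where
  "sum_set L U W = {add L u w | u w. u \<in> U \<and> w \<in> W}"

definition is_direct_sum :: "('f, 'a, 'm) lie_struct_scheme \<Rightarrow> 'a set \<Rightarrow> 'a set \<Rightarrow> bool" where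
  "is_direct_sum L U W \<longleftrightarrow> lie_subspace L U \<and> lie_subspace L W \<and>
     carr L = sum_set L U W \<and> U \<inter> W = {zer L}"

definition lie_quotient ::
    "('f, 'a) lie_struct \<Rightarrow> ('a \<times> 'a) set \<Rightarrow> ('f, 'a set) lie_struct" where
  "lie_quotient L r = \<lparr>
     carr = carr L // r,
     add = (\<lambda>X Y. \<Union>x\<in>X. \<Union>y\<in>Y. r `` {add L x y}),
     zer = r `` {zer L},
     smul = (\<lambda>c X. \<Union>x\<in>X. r `` {smul L c x}),
     brk = (\<lambda>X Y. \<Union>x\<in>X. \<Union>y\<in>Y. r `` {brk L x y})\<rparr>"

definition ideal_rel :: "('f::ring_1, 'a) lie_struct \<Rightarrow> 'a set \<Rightarrow> ('a \<times> 'a) set" where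
  "ideal_rel L J =
     {(x, y). x \<in> carr L \<and> y \<in> carr L \<and> add L x (smul L (-1) y) \<in> J}"

text \<open>Maps are made \<^const>\<open>extensional\<close> (\<^const>\<open>undefined\<close> off the carrier), so that maps
  agreeing on the carrier are equal.\<close>

definition ad_map :: "('f, 'a) lie_struct \<Rightarrow> 'a \<Rightarrow> 'a \<Rightarrow> 'a" where
  "ad_map L x = restrict (\<lambda>y. brk L x y) (carr L)"

definition Der :: "('f::ring_1, 'a) lie_struct \<Rightarrow> ('f, 'a \<Rightarrow> 'a) lie_struct" where
  "Der L = \<lparr>
     carr = {D \<in> carr L \<rightarrow>\<^sub>E carr L.
       (\<forall>x\<in>carr L. \<forall>y\<in>carr L. D (add L x y) = add L (D x) (D y)) \<and>
       (\<forall>c. \<forall>x\<in>carr L. D (smul L c x) = smul L c (D x)) \<and>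
       (\<forall>x\<in>carr L. \<forall>y\<in>carr L. D (brk L x y) = add L (brk L (D x) y) (brk L x (D y)))},
     add = (\<lambda>D D'. restrict (\<lambda>x. add L (D x) (D' x)) (carr L)),
     zer = restrict (\<lambda>x. zer L) (carr L),
     smul = (\<lambda>c D. restrict (\<lambda>x. smul L c (D x)) (carr L)),
     brk = (\<lambda>D D'. restrict (\<lambda>x. add L (D (D' x)) (smul L (-1) (D' (D x)))) (carr L))\<rparr>"


section \<open>Lie algebras presented by generators and relations\<close>

datatype ('f, 'x) lie_term =
    Gen 'x
  | TZero
  | TAdd "('f, 'x) lie_term" "('f, 'x) lie_term"
  | TSmul 'f "('f, 'x) lie_term"
  | TBrk "('f, 'x) lie_term" "('f, 'x) lie_term"

text \<open>The least congruence on formal Lie terms that contains the relations \<open>R\<close> and all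
  instances of the Lie algebra axioms.\<close>

inductive_set lie_cong ::
    "(('f::field, 'x) lie_term \<times> ('f, 'x) lie_term) set \<Rightarrow>
     (('f, 'x) lie_term \<times> ('f, 'x) lie_term) set"
  for R where
  rel: "(s, t) \<in> R \<Longrightarrow> (s, t) \<in> lie_cong R"
| refl: "(t, t) \<in> lie_cong R"
| sym: "(s, t) \<in> lie_cong R \<Longrightarrow> (t, s) \<in> lie_cong R"
| trans: "\<lbrakk>(s, t) \<in> lie_cong R; (t, u) \<in> lie_cong R\<rbrakk> \<Longrightarrow> (s, u) \<in> lie_cong R"
| cong_add: "\<lbrakk>(s, s') \<in> lie_cong R; (t, t') \<in> lie_cong R\<rbrakk> \<Longrightarrow> (TAdd s t, TAdd s' t') \<in> lie_cong R"
| cong_smul: "(t, t') \<in> lie_cong R \<Longrightarrow> (TSmul c t, TSmul c t') \<in> lie_cong R"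
| cong_brk: "\<lbrakk>(s, s') \<in> lie_cong R; (t, t') \<in> lie_cong R\<rbrakk> \<Longrightarrow> (TBrk s t, TBrk s' t') \<in> lie_cong R"
| add_assoc: "(TAdd (TAdd s t) u, TAdd s (TAdd t u)) \<in> lie_cong R"
| add_comm: "(TAdd s t, TAdd t s) \<in> lie_cong R"
| add_zero: "(TAdd t TZero, t) \<in> lie_cong R"
| add_neg: "(TAdd t (TSmul (-1) t), TZero) \<in> lie_cong R"
| smul_add_right: "(TSmul c (TAdd s t), TAdd (TSmul c s) (TSmul c t)) \<in> lie_cong R"
| smul_add_left: "(TSmul (c + d) t, TAdd (TSmul c t) (TSmul d t)) \<in> lie_cong R"
| smul_smul: "(TSmul c (TSmul d t), TSmul (c * d) t) \<in> lie_cong R"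
| smul_one: "(TSmul 1 t, t) \<in> lie_cong R"
| brk_add_left: "(TBrk (TAdd s t) u, TAdd (TBrk s u) (TBrk t u)) \<in> lie_cong R"
| brk_add_right: "(TBrk s (TAdd t u), TAdd (TBrk s t) (TBrk s u)) \<in> lie_cong R"
| brk_smul_left: "(TBrk (TSmul c s) t, TSmul c (TBrk s t)) \<in> lie_cong R"
| brk_smul_right: "(TBrk s (TSmul c t), TSmul c (TBrk s t)) \<in> lie_cong R"
| brk_self: "(TBrk t t, TZero) \<in> lie_cong R"
| jacobi:
    "(TAdd (TBrk s (TBrk t u)) (TAdd (TBrk t (TBrk u s)) (TBrk u (TBrk s t))), TZero) \<in> lie_cong R"

definition term_struct :: "('f, ('f, 'x) lie_term) lie_struct" where
  "term_struct = \<lparr>carr = UNIV, add = TAdd, zer = TZero, smul = TSmul, brk = TBrk\<rparr>"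

definition lie_presented ::
    "(('f::field, 'x) lie_term \<times> ('f, 'x) lie_term) set \<Rightarrow> ('f, ('f, 'x) lie_term set) lie_struct" where
  "lie_presented R = lie_quotient term_struct (lie_cong R)"

definition lie_class ::
    "(('f::field, 'x) lie_term \<times> ('f, 'x) lie_term) set \<Rightarrow>
     ('f, 'x) lie_term \<Rightarrow> ('f, 'x) lie_term set" where
  "lie_class R t = lie_cong R `` {t}"

lemma equiv_lie_cong: "equiv UNIV (lie_cong R)"
  by (rule equivI)
    (auto simp: refl_on_def sym_def trans_def
      intro: lie_cong.refl lie_cong.sym lie_cong.trans)

lemma lie_class_eq_iff: "lie_class R s = lie_class R t \<longleftrightarrow> (s, t) \<in> lie_cong R"
  unfolding lie_class_def using eq_equiv_class_iff[OF equiv_lie_cong] by blast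

lemma lie_presented_ops:
  "carr (lie_presented R) = range (lie_class R)"
  "zer (lie_presented R) = lie_class R TZero"
  "add (lie_presented R) (lie_class R s) (lie_class R t) = lie_class R (TAdd s t)"
  "smul (lie_presented R) c (lie_class R t) = lie_class R (TSmul c t)"
  "brk (lie_presented R) (lie_class R s) (lie_class R t) = lie_class R (TBrk s t)"
proof -
  note eq = equiv_lie_cong[of R]
  show "carr (lie_presented R) = range (lie_class R)"
    by (auto simp: lie_presented_def lie_quotient_def term_struct_def lie_class_def quotient_def)
  show "zer (lie_presented R) = lie_class R TZero"
    by (simp add: lie_presented_def lie_quotient_def term_struct_def lie_class_def)
  have "congruent2 (lie_cong R) (lie_cong R) (\<lambda>s t. lie_cong R `` {TAdd s t})"
    by (rule congruent2I[OF eq eq])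
      (auto intro!: equiv_class_eq[OF eq] intro: lie_cong.cong_add lie_cong.refl)
  from UN_equiv_class2[OF eq eq this]
  show "add (lie_presented R) (lie_class R s) (lie_class R t) = lie_class R (TAdd s t)"
    by (simp add: lie_presented_def lie_quotient_def term_struct_def lie_class_def)
  have "congruent2 (lie_cong R) (lie_cong R) (\<lambda>s t. lie_cong R `` {TBrk s t})"
    by (rule congruent2I[OF eq eq])
      (auto intro!: equiv_class_eq[OF eq] intro: lie_cong.cong_brk lie_cong.refl)
  from UN_equiv_class2[OF eq eq this]
  show "brk (lie_presented R) (lie_class R s) (lie_class R t) = lie_class R (TBrk s t)"
    by (simp add: lie_presented_def lie_quotient_def term_struct_def lie_class_def)
  have "congruent (lie_cong R) (\<lambda>t. lie_cong R `` {TSmul c t})"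
    by (rule congruentI)
      (auto intro!: equiv_class_eq[OF eq] intro: lie_cong.cong_smul)
  from UN_equiv_class[OF eq this]
  show "smul (lie_presented R) c (lie_class R t) = lie_class R (TSmul c t)"
    by (simp add: lie_presented_def lie_quotient_def term_struct_def lie_class_def)
qed

lemma lie_algebra_presented: "lie_algebra (lie_presented R)"
  by unfold_locales
    (auto simp: lie_presented_ops lie_class_eq_iff intro: lie_cong.intros(8-) intro!: rangeI del: equalityI)


section \<open>Generalized Cartan matrices and realizations\<close>

definition gen_cartan_matrix :: "int^'i^'i \<Rightarrow> bool" where
  "gen_cartan_matrix A \<longleftrightarrow> (\<forall>i. A $ i $ i = 2) \<and>
     (\<forall>i j. i \<noteq> j \<longrightarrow> A $ i $ j \<le> 0) \<and> (\<forall>i j. A $ i $ j = 0 \<longleftrightarrow> A $ j $ i = 0)"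

definition indecomposable :: "int^'i^'i \<Rightarrow> bool" where
  "indecomposable A \<longleftrightarrow>
     \<not> (\<exists>S. S \<noteq> {} \<and> S \<noteq> UNIV \<and> (\<forall>i\<in>S. \<forall>j\<in>-S. A $ i $ j = 0 \<and> A $ j $ i = 0))"

text \<open>The index type \<open>'i\<close> plays the role of \<open>I\<close>, and the whole type \<open>'h\<close> that of the Cartan
  subalgebra. Since the rank is at most \<open>CARD('i)\<close>, the condition \<open>dim\<close> makes the dimension
  positive; \<open>vector_space.dim\<close> is 0 on infinite-dimensional spaces, so these are excluded.\<close>

locale realization = vector_space sc
  for sc :: "'f::field_char_0 \<Rightarrow> 'h::ab_group_add \<Rightarrow> 'h" +
  fixes A :: "int^'i^'i::finite"
    and \<alpha> :: "'i \<Rightarrow> 'h \<Rightarrow> 'f"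
    and \<alpha>v :: "'i \<Rightarrow> 'h"
  assumes dim: "dim UNIV + rank (map_matrix of_int A :: 'f^'i^'i) = 2 * CARD('i)"
    and root_linear: "Vector_Spaces.linear sc (*) (\<alpha> i)"
    and roots_independent: "(\<forall>h. (\<Sum>i\<in>UNIV. k i * \<alpha> i h) = 0) \<Longrightarrow> k i = 0"
    and coroots_independent: "(\<Sum>i\<in>UNIV. sc (k i) (\<alpha>v i)) = 0 \<Longrightarrow> k i = 0"
    and root_coroot: "\<alpha> i (\<alpha>v j) = of_int (A $ j $ i)"

definition cartan_center :: "('i \<Rightarrow> 'h \<Rightarrow> 'f::zero) \<Rightarrow> 'h set" where
  "cartan_center \<alpha> = {h. \<forall>i. \<alpha> i h = 0}"


section \<open>The contragredient Lie algebra and the Kac--Moody algebra\<close>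

datatype ('h, 'i) km_gen = GH 'h | GE 'i | GF 'i

abbreviation TH :: "'h \<Rightarrow> ('f, ('h, 'i) km_gen) lie_term" where "TH h \<equiv> Gen (GH h)"
abbreviation TE :: "'i \<Rightarrow> ('f, ('h, 'i) km_gen) lie_term" where "TE i \<equiv> Gen (GE i)"
abbreviation TF :: "'i \<Rightarrow> ('f, ('h, 'i) km_gen) lie_term" where "TF i \<equiv> Gen (GF i)"

text \<open>Every vector of the Cartan subalgebra is a generator, so the linear relations among these
  vectors (\<open>H_add\<close>, \<open>H_smul\<close>) belong to the presentation.\<close>

inductive_set km_rels ::
    "('f::field_char_0 \<Rightarrow> 'h::ab_group_add \<Rightarrow> 'h) \<Rightarrow> int^'i^'i \<Rightarrow> ('i \<Rightarrow> 'h \<Rightarrow> 'f) \<Rightarrow> ('i \<Rightarrow> 'h) \<Rightarrow>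
     (('f, ('h, 'i) km_gen) lie_term \<times> ('f, ('h, 'i) km_gen) lie_term) set"
  for sc A \<alpha> \<alpha>v where
  H_add: "(TH (h + h'), TAdd (TH h) (TH h')) \<in> km_rels sc A \<alpha> \<alpha>v"
| H_smul: "(TH (sc c h), TSmul c (TH h)) \<in> km_rels sc A \<alpha> \<alpha>v"
| HH: "(TBrk (TH h) (TH h'), TZero) \<in> km_rels sc A \<alpha> \<alpha>v"
| EF: "(TBrk (TE i) (TF j), if i = j then TH (\<alpha>v i) else TZero) \<in> km_rels sc A \<alpha> \<alpha>v"
| HE: "(TBrk (TH h) (TE i), TSmul (\<alpha> i h) (TE i)) \<in> km_rels sc A \<alpha> \<alpha>v"
| HF: "(TBrk (TH h) (TF i), TSmul (- \<alpha> i h) (TF i)) \<in> km_rels sc A \<alpha> \<alpha>v"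
| serre_E: "i \<noteq> j \<Longrightarrow> ((TBrk (TE i) ^^ nat (1 - A $ i $ j)) (TE j), TZero) \<in> km_rels sc A \<alpha> \<alpha>v"
| serre_F: "i \<noteq> j \<Longrightarrow> ((TBrk (TF i) ^^ nat (1 - A $ i $ j)) (TF j), TZero) \<in> km_rels sc A \<alpha> \<alpha>v"

type_synonym ('f, 'h, 'i) contra_elt = "('f, ('h, 'i) km_gen) lie_term set"
type_synonym ('f, 'h, 'i) km_elt = "('f, 'h, 'i) contra_elt set"

definition contragredient ::
    "('f::field_char_0 \<Rightarrow> 'h::ab_group_add \<Rightarrow> 'h) \<Rightarrow> int^'i^'i \<Rightarrow> ('i \<Rightarrow> 'h \<Rightarrow> 'f) \<Rightarrow> ('i \<Rightarrow> 'h) \<Rightarrow>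
     ('f, ('f, 'h, 'i) contra_elt) lie_struct" where
  "contragredient sc A \<alpha> \<alpha>v = lie_presented (km_rels sc A \<alpha> \<alpha>v)"

definition contra_H ::
    "('f::field_char_0 \<Rightarrow> 'h::ab_group_add \<Rightarrow> 'h) \<Rightarrow> int^'i^'i \<Rightarrow> ('i \<Rightarrow> 'h \<Rightarrow> 'f) \<Rightarrow> ('i \<Rightarrow> 'h) \<Rightarrow>
     'h \<Rightarrow> ('f, 'h, 'i) contra_elt" where
  "contra_H sc A \<alpha> \<alpha>v h = lie_class (km_rels sc A \<alpha> \<alpha>v) (TH h)"

definition contra_E ::
    "('f::field_char_0 \<Rightarrow> 'h::ab_group_add \<Rightarrow> 'h) \<Rightarrow> int^'i^'i \<Rightarrow> ('i \<Rightarrow> 'h \<Rightarrow> 'f) \<Rightarrow> ('i \<Rightarrow> 'h) \<Rightarrow>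
     'i \<Rightarrow> ('f, 'h, 'i) contra_elt" where
  "contra_E sc A \<alpha> \<alpha>v i = lie_class (km_rels sc A \<alpha> \<alpha>v) (TE i)"

definition km_radical ::
    "('f::field_char_0 \<Rightarrow> 'h::ab_group_add \<Rightarrow> 'h) \<Rightarrow> int^'i^'i \<Rightarrow> ('i \<Rightarrow> 'h \<Rightarrow> 'f) \<Rightarrow> ('i \<Rightarrow> 'h) \<Rightarrow>
     ('f, 'h, 'i) contra_elt set" where
  "km_radical sc A \<alpha> \<alpha>v = (GREATEST J. lie_ideal (contragredient sc A \<alpha> \<alpha>v) J \<and>
     J \<inter> range (contra_H sc A \<alpha> \<alpha>v) = {zer (contragredient sc A \<alpha> \<alpha>v)})"

definition km_proj ::
    "('f::field_char_0 \<Rightarrow> 'h::ab_group_add \<Rightarrow> 'h) \<Rightarrow> int^'i^'i \<Rightarrow> ('i \<Rightarrow> 'h \<Rightarrow> 'f) \<Rightarrow> ('i \<Rightarrow> 'h) \<Rightarrow>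
     ('f, 'h, 'i) contra_elt \<Rightarrow> ('f, 'h, 'i) km_elt" where
  "km_proj sc A \<alpha> \<alpha>v x =
     ideal_rel (contragredient sc A \<alpha> \<alpha>v) (km_radical sc A \<alpha> \<alpha>v) `` {x}"

definition kac_moody ::
    "('f::field_char_0 \<Rightarrow> 'h::ab_group_add \<Rightarrow> 'h) \<Rightarrow> int^'i^'i \<Rightarrow> ('i \<Rightarrow> 'h \<Rightarrow> 'f) \<Rightarrow> ('i \<Rightarrow> 'h) \<Rightarrow>
     ('f, ('f, 'h, 'i) km_elt) lie_struct" where
  "kac_moody sc A \<alpha> \<alpha>v = lie_quotient (contragredient sc A \<alpha> \<alpha>v)
     (ideal_rel (contragredient sc A \<alpha> \<alpha>v) (km_radical sc A \<alpha> \<alpha>v))"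

definition km_H ::
    "('f::field_char_0 \<Rightarrow> 'h::ab_group_add \<Rightarrow> 'h) \<Rightarrow> int^'i^'i \<Rightarrow> ('i \<Rightarrow> 'h \<Rightarrow> 'f) \<Rightarrow> ('i \<Rightarrow> 'h) \<Rightarrow>
     'h \<Rightarrow> ('f, 'h, 'i) km_elt" where
  "km_H sc A \<alpha> \<alpha>v h = km_proj sc A \<alpha> \<alpha>v (contra_H sc A \<alpha> \<alpha>v h)"

definition km_E ::
    "('f::field_char_0 \<Rightarrow> 'h::ab_group_add \<Rightarrow> 'h) \<Rightarrow> int^'i^'i \<Rightarrow> ('i \<Rightarrow> 'h \<Rightarrow> 'f) \<Rightarrow> ('i \<Rightarrow> 'h) \<Rightarrow>
     'i \<Rightarrow> ('f, 'h, 'i) km_elt" where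
  "km_E sc A \<alpha> \<alpha>v i = km_proj sc A \<alpha> \<alpha>v (contra_E sc A \<alpha> \<alpha>v i)"


section \<open>Borel subalgebras and the derivations coming from the Cartan subalgebra\<close>

text \<open>In a Lie algebra \<open>L\<close>, let \<open>\<iota>\<close> be the structure map from the Cartan subalgebra and \<open>e\<close> the
  family of positive Chevalley generators.\<close>

definition n_plus :: "('f, 'a) lie_struct \<Rightarrow> ('i \<Rightarrow> 'a) \<Rightarrow> 'a set" where
  "n_plus L e = lie_generated L (range e)"

definition borel ::
    "('f, 'a) lie_struct \<Rightarrow> ('h \<Rightarrow> 'a) \<Rightarrow> ('i \<Rightarrow> 'a) \<Rightarrow> ('f, 'a) lie_struct" where
  "borel L \<iota> e = L\<lparr>carr := sum_set L (range \<iota>) (n_plus L e)\<rparr>"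

definition hom_cartan_center ::
    "('f::field \<Rightarrow> 'h::ab_group_add \<Rightarrow> 'h) \<Rightarrow> ('i \<Rightarrow> 'h \<Rightarrow> 'f) \<Rightarrow>
     ('f, 'a) lie_struct \<Rightarrow> ('h \<Rightarrow> 'a) \<Rightarrow> ('i \<Rightarrow> 'a) \<Rightarrow> ('a \<Rightarrow> 'a) set" where
  "hom_cartan_center sc \<alpha> L \<iota> e =
     {D \<in> extensional (carr (borel L \<iota> e)).
        \<exists>\<phi>. Vector_Spaces.linear sc sc \<phi> \<and> range \<phi> \<subseteq> cartan_center \<alpha> \<and>
          (\<forall>h. \<forall>x\<in>n_plus L e. D (add L (\<iota> h) x) = \<iota> (\<phi> h))}"

definition contra_borel ::
    "('f::field_char_0 \<Rightarrow> 'h::ab_group_add \<Rightarrow> 'h) \<Rightarrow> int^'i^'i \<Rightarrow> ('i \<Rightarrow> 'h \<Rightarrow> 'f) \<Rightarrow> ('i \<Rightarrow> 'h) \<Rightarrow>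
     ('f, ('f, 'h, 'i) contra_elt) lie_struct" where
  "contra_borel sc A \<alpha> \<alpha>v =
     borel (contragredient sc A \<alpha> \<alpha>v) (contra_H sc A \<alpha> \<alpha>v) (contra_E sc A \<alpha> \<alpha>v)"

definition km_borel ::
    "('f::field_char_0 \<Rightarrow> 'h::ab_group_add \<Rightarrow> 'h) \<Rightarrow> int^'i^'i \<Rightarrow> ('i \<Rightarrow> 'h \<Rightarrow> 'f) \<Rightarrow> ('i \<Rightarrow> 'h) \<Rightarrow>
     ('f, ('f, 'h, 'i) km_elt) lie_struct" where
  "km_borel sc A \<alpha> \<alpha>v =
     borel (kac_moody sc A \<alpha> \<alpha>v) (km_H sc A \<alpha> \<alpha>v) (km_E sc A \<alpha> \<alpha>v)"

end

theory Submission
  imports Defs "HOL-Library.Function_Algebras"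
begin

text \<open>Let \<open>h \<in> H\<close> satisfy \<open>\<alpha>\<^sub>i(h) = 1\<close> and \<open>\<alpha>\<^sub>j(h) = 2\<close> for \<open>j \<noteq> i\<close>. On the nilpotent part, \<open>ad h\<close> is
  diagonalizable with positive integer eigenvalues, hence bijective, and its 1-eigenspace is the line
  through \<open>e\<^sub>i\<close>. Let \<open>D\<close> be a derivation of the Borel subalgebra. Subtracting an inner derivation, we
  may assume \<open>D h \<in> H\<close>. Then \<open>D\<close> maps \<open>H\<close> into the centralizer of \<open>h\<close>, which is \<open>H\<close>, and
  applying \<open>D\<close> to \<open>[h', e\<^sub>i] = \<alpha>\<^sub>i(h') e\<^sub>i\<close> shows that \<open>D e\<^sub>i\<close> is a multiple of \<open>e\<^sub>i\<close> and that
  \<open>\<alpha>\<^sub>i(D h') = 0\<close>. The multiples are those of \<open>ad s\<close> for some \<open>s \<in> H\<close>, and what remains is a map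
  from \<open>H\<close> to the center.

  This uses that \<open>H\<close> embeds in both algebras and that \<open>e\<^sub>i \<noteq> 0\<close>. For \<open>L(A)\<close>, every weight
  \<open>\<omega> \<in> H\<^sup>*\<close> gives a representation by operators on functions on words in \<open>I\<close> (the dual of the
  tensor algebra), in which \<open>e\<^sub>i\<close> is a shift: the negative Serre elements act by 0 because they commute
  with all shifts, the positive ones act by 0 on the submodule generated by the indicator of the empty
  word, and \<open>h\<close> multiplies that vector by \<open>\<omega>(h)\<close>. For \<open>g(A)\<close>, the triangular decomposition of
  \<open>L(A)\<close> shows that the sum of two ideals that avoid \<open>H\<close> avoids \<open>H\<close>, so that a greatest one exists.\<close>

section \<open>Lie algebras on carriers\<close>

context lie_algebra
begin

abbreviation plus_L (infixl "\<oplus>" 65) where "x \<oplus> y \<equiv> add L x y"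
abbreviation scale_L (infixr "\<odot>" 75) where "c \<odot> x \<equiv> smul L c x"
abbreviation zero_L ("\<zero>") where "\<zero> \<equiv> zer L"
abbreviation brk_L ("\<lbrace>_,_\<rbrace>") where "\<lbrace>x,y\<rbrace> \<equiv> brk L x y"

lemmas closed [simp] = add_closed zer_closed smul_closed brk_closed

declare add_zer [simp]

lemma add_left_comm:
  "\<lbrakk>x \<in> carr L; y \<in> carr L; z \<in> carr L\<rbrakk> \<Longrightarrow> x \<oplus> (y \<oplus> z) = y \<oplus> (x \<oplus> z)"
  by (metis add_assoc add_comm)

lemmas add_ac = add_assoc add_comm add_left_comm

lemma zer_add [simp]: "x \<in> carr L \<Longrightarrow> \<zero> \<oplus> x = x"
  by (metis add_comm add_zer zer_closed)

lemma add_cancel: "\<lbrakk>x \<in> carr L; y \<in> carr L; z \<in> carr L\<rbrakk> \<Longrightarrow> x \<oplus> y = x \<oplus> z \<longleftrightarrow> y = z"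
proof
  assume *: "x \<in> carr L" "y \<in> carr L" "z \<in> carr L" "x \<oplus> y = x \<oplus> z"
  have "((-1) \<odot> x \<oplus> x) \<oplus> y = ((-1) \<odot> x \<oplus> x) \<oplus> z"
    using * by (simp add: add_assoc)
  then show "y = z" using * by (simp add: add_comm[of "(-1) \<odot> x"] add_neg)
qed simp

lemma zero_smul [simp]: "x \<in> carr L \<Longrightarrow> 0 \<odot> x = \<zero>"
  using smul_add_left[of x 0 0] add_cancel[of "0 \<odot> x" "0 \<odot> x" \<zero>] by simp

lemma smul_zer [simp]: "c \<odot> \<zero> = \<zero>"
  using smul_add_right[of \<zero> \<zero> c] add_cancel[of "c \<odot> \<zero>" "c \<odot> \<zero>" \<zero>] by simp

lemma brk_zer_left [simp]: "x \<in> carr L \<Longrightarrow> \<lbrace>\<zero>,x\<rbrace> = \<zero>"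
  using brk_smul_left[of \<zero> x 0] by simp

lemma brk_zer_right [simp]: "x \<in> carr L \<Longrightarrow> \<lbrace>x,\<zero>\<rbrace> = \<zero>"
  using brk_smul_right[of x \<zero> 0] by simp

lemma smul_eq_zer: "x \<in> carr L \<Longrightarrow> c \<odot> x = \<zero> \<longleftrightarrow> c = 0 \<or> x = \<zero>"
proof
  assume x: "x \<in> carr L" and *: "c \<odot> x = \<zero>"
  show "c = 0 \<or> x = \<zero>"
  proof (cases "c = 0")
    case False
    then have "x = inverse c \<odot> c \<odot> x" using x by (simp add: smul_smul smul_one)
    then show ?thesis using * by simp
  qed simp
qed auto

lemma add_eq_zer_iff: "\<lbrakk>x \<in> carr L; y \<in> carr L\<rbrakk> \<Longrightarrow> x \<oplus> y = \<zero> \<longleftrightarrow> y = (-1) \<odot> x"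
  by (metis add_cancel add_neg smul_closed)

lemma diff_eq_zer_iff: "\<lbrakk>x \<in> carr L; y \<in> carr L\<rbrakk> \<Longrightarrow> x \<oplus> (-1) \<odot> y = \<zero> \<longleftrightarrow> x = y"
  by (metis add_cancel add_comm add_neg smul_closed)

lemma eq_diff_iff:
  "\<lbrakk>x \<in> carr L; y \<in> carr L; z \<in> carr L\<rbrakk> \<Longrightarrow> x = z \<oplus> (-1) \<odot> y \<longleftrightarrow> x \<oplus> y = z"
proof -
  assume *: "x \<in> carr L" "y \<in> carr L" "z \<in> carr L"
  have "(z \<oplus> (-1) \<odot> y) \<oplus> y = z"
    using * by (metis add_assoc add_comm add_neg add_zer smul_closed)
  then show ?thesis using * by (metis add_cancel add_comm add_closed smul_closed)
qed

lemma brk_swap: "\<lbrakk>x \<in> carr L; y \<in> carr L\<rbrakk> \<Longrightarrow> \<lbrace>y,x\<rbrace> = (-1) \<odot> \<lbrace>x,y\<rbrace>"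
proof -
  assume *: "x \<in> carr L" "y \<in> carr L"
  have "\<lbrace>x \<oplus> y, x \<oplus> y\<rbrace> = \<lbrace>x,y\<rbrace> \<oplus> \<lbrace>y,x\<rbrace>"
    using * by (simp add: brk_add_left brk_add_right) (simp add: brk_self add_comm)
  then have "\<lbrace>x,y\<rbrace> \<oplus> \<lbrace>y,x\<rbrace> = \<zero>" using * by (simp add: brk_self)
  then show ?thesis using * by (simp add: add_eq_zer_iff)
qed

lemma jacobi_left:
  assumes "x \<in> carr L" "y \<in> carr L" "z \<in> carr L"
  shows "\<lbrace>x,\<lbrace>y,z\<rbrace>\<rbrace> = \<lbrace>\<lbrace>x,y\<rbrace>,z\<rbrace> \<oplus> \<lbrace>y,\<lbrace>x,z\<rbrace>\<rbrace>"
proof -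
  have 1: "\<lbrace>y,\<lbrace>z,x\<rbrace>\<rbrace> = (-1) \<odot> \<lbrace>y,\<lbrace>x,z\<rbrace>\<rbrace>"
    using assms by (subst brk_swap[of x z]) (simp_all add: brk_smul_right)
  have 2: "\<lbrace>z,\<lbrace>x,y\<rbrace>\<rbrace> = (-1) \<odot> \<lbrace>\<lbrace>x,y\<rbrace>,z\<rbrace>"
    using assms by (subst brk_swap[of "\<lbrace>x,y\<rbrace>" z]) simp_all
  have "\<lbrace>x,\<lbrace>y,z\<rbrace>\<rbrace> \<oplus> (-1) \<odot> (\<lbrace>\<lbrace>x,y\<rbrace>,z\<rbrace> \<oplus> \<lbrace>y,\<lbrace>x,z\<rbrace>\<rbrace>) = \<zero>"
    using jacobi[OF assms] assms unfolding 1 2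
    by (simp add: smul_add_right add_comm)
  then show ?thesis using assms by (simp add: diff_eq_zer_iff)
qed

lemma jacobi_right:
  assumes "x \<in> carr L" "y \<in> carr L" "z \<in> carr L"
  shows "\<lbrace>\<lbrace>x,y\<rbrace>,z\<rbrace> = \<lbrace>x,\<lbrace>y,z\<rbrace>\<rbrace> \<oplus> (-1) \<odot> \<lbrace>y,\<lbrace>x,z\<rbrace>\<rbrace>"
  using assms by (subst eq_diff_iff) (simp_all add: jacobi_left[OF assms])

section \<open>Linear subspaces and generated subalgebras\<close>

lemma subspace_carr: "lie_subspace L U \<Longrightarrow> x \<in> U \<Longrightarrow> x \<in> carr L"
  by (auto simp: lie_subspace_def)

lemma subspace_zer: "lie_subspace L U \<Longrightarrow> \<zero> \<in> U"
  by (auto simp: lie_subspace_def)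

lemma subspace_add: "lie_subspace L U \<Longrightarrow> x \<in> U \<Longrightarrow> y \<in> U \<Longrightarrow> x \<oplus> y \<in> U"
  by (auto simp: lie_subspace_def)

lemma subspace_smul: "lie_subspace L U \<Longrightarrow> x \<in> U \<Longrightarrow> c \<odot> x \<in> U"
  by (auto simp: lie_subspace_def)

lemma subspace_smulD:
  assumes "lie_subspace L U" "c \<odot> x \<in> U" "c \<noteq> 0" "x \<in> carr L"
  shows "x \<in> U"
  using subspace_smul[OF assms(1,2), of "inverse c"] assms(3,4) by (simp add: smul_smul smul_one)

lemma subspace_addD:
  assumes "lie_subspace L U" "x \<oplus> y \<in> U" "y \<in> U" "x \<in> carr L"
  shows "x \<in> U"
proof -
  have y: "y \<in> carr L" using assms subspace_carr by blast
  have "x = (x \<oplus> y) \<oplus> (-1) \<odot> y"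
    using assms y by (subst eq_diff_iff) simp_all
  then show ?thesis using assms subspace_add subspace_smul by metis
qed

lemma subspace_trivial: "lie_subspace L {\<zero>}"
  by (simp add: lie_subspace_def)

lemma subspace_line: "x \<in> carr L \<Longrightarrow> lie_subspace L (range (\<lambda>c. c \<odot> x))"
  unfolding lie_subspace_def
  by (intro conjI) (auto simp: smul_smul smul_add_left[symmetric] image_iff, metis zero_smul)

lemma generated_least: "lie_subalgebra L U \<Longrightarrow> S \<subseteq> U \<Longrightarrow> lie_generated L S \<subseteq> U"
  by (auto simp: lie_generated_def)

lemma generated_incl: "S \<subseteq> lie_generated L S"
  by (auto simp: lie_generated_def)

lemma subalgebra_carr: "lie_subalgebra L (carr L)"
  by (auto simp: lie_subalgebra_def lie_subspace_def)

lemma subalgebra_generated: "S \<subseteq> carr L \<Longrightarrow> lie_subalgebra L (lie_generated L S)"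
  using subalgebra_carr unfolding lie_generated_def
  by (auto simp: lie_subalgebra_def lie_subspace_def)

section \<open>Finite sums and linear operators on the carrier\<close>

primrec lsum :: "nat \<Rightarrow> (nat \<Rightarrow> 'a) \<Rightarrow> 'a" where
  "lsum 0 c = \<zero>"
| "lsum (Suc n) c = lsum n c \<oplus> c n"

lemma lsum_in_subspace:
  "lie_subspace L U \<Longrightarrow> (\<And>n. n < m \<Longrightarrow> c n \<in> U) \<Longrightarrow> lsum m c \<in> U"
  by (induction m) (auto intro: subspace_zer subspace_add)

lemma lsum_closed [simp]: "(\<And>n. c n \<in> carr L) \<Longrightarrow> lsum m c \<in> carr L"
  by (induction m) simp_all

lemma lsum_cong: "(\<And>n. n < m \<Longrightarrow> c n = d n) \<Longrightarrow> lsum m c = lsum m d"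
  by (induction m) auto

lemma lsum_add:
  assumes "\<And>n. c n \<in> carr L" "\<And>n. d n \<in> carr L"
  shows "lsum m (\<lambda>n. c n \<oplus> d n) = lsum m c \<oplus> lsum m d"
  by (induction m) (use assms in \<open>simp_all add: add_ac\<close>)

text \<open>Padding with zeros brings sums of different lengths to a common length, so that they can
  be added term by term.\<close>

lemma lsum_pad:
  assumes "\<And>n. c n \<in> carr L"
  shows "lsum (m + k) (\<lambda>n. if n < m then c n else \<zero>) = lsum m c"
proof (induction k)
  case 0
  show ?case by (auto intro: lsum_cong)
next
  case (Suc k)
  then show ?case using assms by simp
qed

lemma lsum_single:
  assumes "v \<in> carr L"
  shows "lsum (Suc n) (\<lambda>k. if k = n then v else \<zero>) = v"
proof -
  have "lsum n (\<lambda>k. if k = n then v else \<zero>) = lsum n (\<lambda>k. \<zero>)" by (rule lsum_cong) simp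
  also have "\<dots> = \<zero>" by (induction n) simp_all
  finally show ?thesis using assms by simp
qed

definition linear_op :: "('a \<Rightarrow> 'a) \<Rightarrow> bool" where
  "linear_op T \<longleftrightarrow> (\<forall>x\<in>carr L. T x \<in> carr L) \<and>
     (\<forall>x\<in>carr L. \<forall>y\<in>carr L. T (x \<oplus> y) = T x \<oplus> T y) \<and> (\<forall>c. \<forall>x\<in>carr L. T (c \<odot> x) = c \<odot> T x)"

lemma linear_op_brk: "x \<in> carr L \<Longrightarrow> linear_op (brk L x)"
  by (simp add: linear_op_def brk_add_right brk_smul_right)

lemma linear_op_smul: "linear_op (smul L c)"
  by (simp add: linear_op_def smul_add_right smul_smul mult.commute)

lemma linear_op_comp: "linear_op S \<Longrightarrow> linear_op T \<Longrightarrow> linear_op (\<lambda>x. S (T x))"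
  by (simp add: linear_op_def)

lemma linear_op_add: "linear_op S \<Longrightarrow> linear_op T \<Longrightarrow> linear_op (\<lambda>x. S x \<oplus> T x)"
  by (simp add: linear_op_def add_ac smul_add_right)

lemma linear_op_lsum:
  assumes "linear_op T" "\<And>n. c n \<in> carr L"
  shows "T (lsum m c) = lsum m (\<lambda>n. T (c n))"
proof (induction m)
  case 0
  have "T (0 \<odot> \<zero>) = 0 \<odot> T \<zero>" using assms(1) zer_closed unfolding linear_op_def by blast
  moreover have "T \<zero> \<in> carr L" using assms(1) by (simp add: linear_op_def)
  ultimately show ?case by simp
next
  case (Suc m)
  then show ?case using assms by (simp add: linear_op_def)
qed

text \<open>\<open>T\<close> minus \<mu> m kills the last eigenvector and rescales the others by the
  nonzero factors \<mu> k - \<mu> m, which gives an induction on the number of summands. For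
  \<open>J\<close> the zero space this is the linear independence of eigenvectors for distinct
  eigenvalues.\<close>

lemma eigenvector_components:
  assumes J: "lie_subspace L J" and T: "linear_op T" "\<And>x. x \<in> J \<Longrightarrow> T x \<in> J"
  shows "(\<And>n. c n \<in> carr L) \<Longrightarrow> (\<And>n. T (c n) = \<mu> n \<odot> c n) \<Longrightarrow> inj \<mu> \<Longrightarrow>
    lsum m c \<in> J \<Longrightarrow> n < m \<Longrightarrow> c n \<in> J"
proof (induction m arbitrary: c n)
  case (Suc m)
  let ?S = "\<lambda>x. T x \<oplus> (- \<mu> m) \<odot> x"
  have S: "linear_op ?S" by (intro linear_op_add T linear_op_smul)
  have Sc: "?S (c k) = (\<mu> k - \<mu> m) \<odot> c k" for k
    using Suc.prems(1,2) by (simp add: smul_add_left[symmetric])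
  have "?S (lsum (Suc m) c) \<in> J"
    using Suc.prems(4) J T by (blast intro: subspace_add subspace_smul)
  also have "?S (lsum (Suc m) c) = lsum (Suc m) (\<lambda>k. (\<mu> k - \<mu> m) \<odot> c k)"
    unfolding linear_op_lsum[OF S Suc.prems(1)] Sc ..
  finally have red: "lsum m (\<lambda>k. (\<mu> k - \<mu> m) \<odot> c k) \<in> J"
    using Suc.prems(1) by simp
  have "(\<mu> k - \<mu> m) \<odot> c k \<in> J" if "k < m" for k
  proof (rule Suc.IH[OF _ _ Suc.prems(3) _ that])
    show "T ((\<mu> k - \<mu> m) \<odot> c k) = \<mu> k \<odot> (\<mu> k - \<mu> m) \<odot> c k" for k
      using Suc.prems(1,2) T(1) by (simp add: linear_op_def smul_smul mult.commute)
  qed (use Suc.prems(1) red in auto)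
  then have *: "(\<mu> k - \<mu> m) \<odot> c k \<in> J" if "k < m" for k using that by blast
  have lt: "c k \<in> J" if "k < m" for k
  proof -
    have "\<mu> k - \<mu> m \<noteq> 0" using that Suc.prems(3) by (auto dest: injD)
    then show ?thesis using *[OF that] subspace_smulD[OF J] Suc.prems(1) by blast
  qed
  \<comment> \<open>The partial sum now lies in \<open>J\<close>, so the last component is recovered
    by subtraction.\<close>
  then have "lsum m c \<in> J" using lsum_in_subspace[OF J] by blast
  moreover have "c m \<oplus> lsum m c \<in> J" using Suc.prems(1,4) by (simp add: add_comm)
  ultimately have "c m \<in> J" using subspace_addD[OF J] Suc.prems(1) by blast
  then show ?case using lt Suc.prems(5) less_Suc_eq by metis
qed simp

end

section \<open>The eigenvalue grading of the nilpotent part\<close>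

lemma (in lie_algebra) linear_op_brk_left: "x \<in> carr L \<Longrightarrow> linear_op (\<lambda>y. \<lbrace>y,x\<rbrace>)"
  by (simp add: linear_op_def brk_add_left brk_smul_left)

text \<open>Common setting for the positive halves of L(A) and g(A) and, with the roots negated, for
  the negative half of L(A).\<close>

locale half_borel = lie_algebra L
  for L :: "('f::field_char_0, 'a) lie_struct" +
  fixes sc :: "'f \<Rightarrow> 'h::ab_group_add \<Rightarrow> 'h"
    and \<alpha> :: "'i \<Rightarrow> 'h \<Rightarrow> 'f"
    and \<iota> :: "'h \<Rightarrow> 'a"
    and e :: "'i \<Rightarrow> 'a"
  assumes \<iota>_closed [simp]: "\<iota> h \<in> carr L"
    and \<iota>_add: "\<iota> (h + h') = \<iota> h \<oplus> \<iota> h'"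
    and \<iota>_smul: "\<iota> (sc c h) = c \<odot> \<iota> h"
    and \<iota>_brk [simp]: "\<lbrace>\<iota> h,\<iota> h'\<rbrace> = \<zero>"
    and e_closed [simp]: "e i \<in> carr L"
    and \<iota>_e: "\<lbrace>\<iota> h,e i\<rbrace> = \<alpha> i h \<odot> e i"
    and roots_separate: "\<exists>h. \<forall>i. \<alpha> i h = k i"
begin

abbreviation "N \<equiv> n_plus L e"
abbreviation "B \<equiv> borel L \<iota> e"

lemma N_subalgebra: "lie_subalgebra L N"
  unfolding n_plus_def by (rule subalgebra_generated) auto

lemma N_subspace: "lie_subspace L N"
  using N_subalgebra by (simp add: lie_subalgebra_def)

lemma N_carr [simp]: "x \<in> N \<Longrightarrow> x \<in> carr L"
  using N_subspace subspace_carr by blast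

lemma N_zer [simp]: "\<zero> \<in> N"
  using N_subspace subspace_zer by blast

lemma N_add [simp]: "x \<in> N \<Longrightarrow> y \<in> N \<Longrightarrow> x \<oplus> y \<in> N"
  using N_subspace subspace_add by blast

lemma N_smul [simp]: "x \<in> N \<Longrightarrow> c \<odot> x \<in> N"
  using N_subspace subspace_smul by blast

lemma N_brk [simp]: "x \<in> N \<Longrightarrow> y \<in> N \<Longrightarrow> \<lbrace>x,y\<rbrace> \<in> N"
  using N_subalgebra by (simp add: lie_subalgebra_def)

lemma e_in_N [simp]: "e i \<in> N"
  using generated_incl by (fastforce simp: n_plus_def)

lemma N_induct [consumes 1, case_names e zer add smul brk]:
  assumes "x \<in> N" "\<And>i. P (e i)" "P \<zero>"
    and "\<And>x y. \<lbrakk>x \<in> N; y \<in> N; P x; P y\<rbrakk> \<Longrightarrow> P (x \<oplus> y)"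
    and "\<And>c x. \<lbrakk>x \<in> N; P x\<rbrakk> \<Longrightarrow> P (c \<odot> x)"
    and "\<And>x y. \<lbrakk>x \<in> N; y \<in> N; P x; P y\<rbrakk> \<Longrightarrow> P \<lbrace>x,y\<rbrace>"
  shows "P x"
proof -
  have "lie_subalgebra L {x \<in> N. P x}"
    using assms(2-) by (auto simp: lie_subalgebra_def lie_subspace_def)
  moreover have "range e \<subseteq> {x \<in> N. P x}" using assms(2) by auto
  ultimately have "N \<subseteq> {x \<in> N. P x}"
    unfolding n_plus_def by (rule generated_least)
  then show ?thesis using assms(1) by blast
qed

lemma \<iota>_N [simp]: "x \<in> N \<Longrightarrow> \<lbrace>\<iota> h,x\<rbrace> \<in> N"
  by (induction rule: N_induct) (simp_all add: \<iota>_e brk_add_right brk_smul_right jacobi_left[of "\<iota> h"])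

lemma N_\<iota> [simp]: "x \<in> N \<Longrightarrow> \<lbrace>x,\<iota> h\<rbrace> \<in> N"
  using brk_swap[of "\<iota> h" x] by simp

text \<open>Eigenvalues of a single such element \<open>h\<close> isolate a root without a grading by the whole root
  lattice.\<close>

definition isolates :: "'i \<Rightarrow> 'h \<Rightarrow> bool" where
  "isolates i h \<longleftrightarrow> \<alpha> i h = 1 \<and> (\<forall>j. j \<noteq> i \<longrightarrow> \<alpha> j h = 2)"

lemma ex_isolates: "\<exists>h. isolates i h"
  using roots_separate[of "\<lambda>j. if j = i then 1 else 2"] by (metis isolates_def)

definition line :: "'i \<Rightarrow> 'a set" where "line i = range (\<lambda>c. c \<odot> e i)"

lemma line_subspace: "lie_subspace L (line i)"
  by (simp add: line_def subspace_line)

lemma e_line: "e i \<in> line i"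
  unfolding line_def by (metis e_closed rangeI smul_one)

text \<open>The eigenspace for \<open>n\<close>, with two facts built in that the eigenvalue alone
  does not give: degree 0 is trivial, and degree 1 contains only multiples of \<open>e i\<close>. As
  part of the definition they propagate through brackets.\<close>

definition piece :: "'i \<Rightarrow> 'h \<Rightarrow> nat \<Rightarrow> 'a set" where
  "piece i h n = {x \<in> N. \<lbrace>\<iota> h,x\<rbrace> = of_nat n \<odot> x \<and> (n = 0 \<longrightarrow> x = \<zero>) \<and>
     (n = 1 \<longrightarrow> x \<in> line i)}"

lemma piece_zer: "\<zero> \<in> piece i h n"
  using subspace_zer[OF line_subspace] by (simp add: piece_def)

lemma piece_N: "x \<in> piece i h n \<Longrightarrow> x \<in> N"
  by (simp add: piece_def)

lemma piece_eigen: "x \<in> piece i h n \<Longrightarrow> \<lbrace>\<iota> h,x\<rbrace> = of_nat n \<odot> x"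
  by (simp add: piece_def)

lemma piece_add: "x \<in> piece i h n \<Longrightarrow> y \<in> piece i h n \<Longrightarrow> x \<oplus> y \<in> piece i h n"
  by (auto simp: piece_def brk_add_right smul_add_right intro: subspace_add[OF line_subspace])

lemma piece_smul: "x \<in> piece i h n \<Longrightarrow> c \<odot> x \<in> piece i h n"
  by (auto simp: piece_def brk_smul_right smul_smul mult.commute
      intro!: subspace_smul[OF line_subspace])

text \<open>Eigenvalues add by the Jacobi identity. If both degrees are positive, their sum is at
  least 2 and the extra conditions are vacuous.\<close>

lemma piece_brk:
  assumes x: "x \<in> piece i h n" and y: "y \<in> piece i h k"
  shows "\<lbrace>x,y\<rbrace> \<in> piece i h (n + k)"
proof (cases "n = 0 \<or> k = 0")
  case True
  then have "\<lbrace>x,y\<rbrace> = \<zero>" using x y by (auto simp: piece_def)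
  then show ?thesis using piece_zer by simp
next
  case False
  then show ?thesis using x y
    by (simp add: piece_def jacobi_left[of "\<iota> h"] brk_smul_right brk_smul_left smul_add_left)
qed

definition graded :: "'i \<Rightarrow> 'h \<Rightarrow> 'a set" where
  "graded i h = {lsum m c | m c. \<forall>n. c n \<in> piece i h n}"

lemma graded_piece:
  assumes "x \<in> piece i h n" shows "x \<in> graded i h"
proof -
  have "lsum (Suc n) (\<lambda>k. if k = n then x else \<zero>) = x"
    using assms by (intro lsum_single) (simp add: piece_N)
  then show ?thesis
    unfolding graded_def using assms piece_zer
    by (intro CollectI exI[of _ "Suc n"] exI[of _ "\<lambda>k. if k = n then x else \<zero>"]) auto
qed

lemma piece_carr: "x \<in> piece i h n \<Longrightarrow> x \<in> carr L"
  by (simp add: piece_N)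

lemma graded_subspace: "lie_subspace L (graded i h)"
  unfolding lie_subspace_def
proof (intro conjI ballI allI)
  show "graded i h \<subseteq> carr L"
    by (auto simp: graded_def intro!: lsum_closed intro: piece_carr)
  show "\<zero> \<in> graded i h"
    using graded_piece[OF piece_zer] .
next
  fix x y assume "x \<in> graded i h" "y \<in> graded i h"
  then obtain m c m' c' where *: "\<forall>n. c n \<in> piece i h n" "\<forall>n. c' n \<in> piece i h n"
    "x = lsum m c" "y = lsum m' c'" unfolding graded_def by blast
  let ?c = "\<lambda>n. if n < m then c n else \<zero>" and ?c' = "\<lambda>n. if n < m' then c' n else \<zero>"
  have "lsum (m + m') (\<lambda>n. ?c n \<oplus> ?c' n) = lsum (m + m') ?c \<oplus> lsum (m' + m) ?c'"
    using * by (subst lsum_add) (auto simp: add.commute intro: piece_carr)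
  also have "\<dots> = x \<oplus> y"
    using *(1,2)[rule_format, THEN piece_carr] *(3,4) by (simp add: lsum_pad)
  finally show "x \<oplus> y \<in> graded i h"
    unfolding graded_def using * piece_zer piece_add
    by (intro CollectI exI[of _ "m + m'"] exI[of _ "\<lambda>n. ?c n \<oplus> ?c' n"]) auto
next
  fix a x assume "x \<in> graded i h"
  then obtain m c where *: "\<forall>n. c n \<in> piece i h n" "x = lsum m c" unfolding graded_def by blast
  then have "a \<odot> x = lsum m (\<lambda>n. a \<odot> c n)"
    by (auto intro!: linear_op_lsum linear_op_smul intro: piece_carr)
  then show "a \<odot> x \<in> graded i h"
    unfolding graded_def using * piece_smul by blast
qed

text \<open>The generators have degree 1 or 2 and brackets add degrees, so the sums of homogeneous
  elements form a subalgebra that contains the generators.\<close>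

lemma N_graded:
  assumes h: "isolates i h" and x: "x \<in> N"
  shows "x \<in> graded i h"
  using x
proof (induction rule: N_induct)
  case (e j)
  show ?case
  proof (cases "j = i")
    case True
    then have "e j \<in> piece i h 1"
      using h e_line by (simp add: piece_def \<iota>_e isolates_def)
    then show ?thesis by (rule graded_piece)
  next
    case False
    then have "e j \<in> piece i h 2"
      using h False by (simp add: piece_def \<iota>_e isolates_def)
    then show ?thesis by (rule graded_piece)
  qed
next
  case zer
  show ?case by (rule subspace_zer[OF graded_subspace])
next
  case (brk x y)
  then obtain m c m' c' where *: "\<And>n. c n \<in> piece i h n" "\<And>n. c' n \<in> piece i h n"
    "x = lsum m c" "y = lsum m' c'" unfolding graded_def by blast
  have "\<lbrace>c n,y\<rbrace> \<in> graded i h" for n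
  proof -
    have "\<lbrace>c n,y\<rbrace> = lsum m' (\<lambda>k. \<lbrace>c n,c' k\<rbrace>)"
      unfolding *(4) using *(1,2) piece_carr by (blast intro: linear_op_lsum linear_op_brk)
    then show ?thesis
      using * by (auto intro!: lsum_in_subspace[OF graded_subspace] graded_piece[OF piece_brk])
  qed
  moreover have "\<lbrace>x,y\<rbrace> = lsum m (\<lambda>n. \<lbrace>c n,y\<rbrace>)"
    unfolding *(3) using *(1) brk(2) by (intro linear_op_lsum linear_op_brk_left) (auto intro: piece_carr)
  ultimately show ?case
    by (auto intro!: lsum_in_subspace[OF graded_subspace])
qed (auto intro: subspace_add[OF graded_subspace] subspace_smul[OF graded_subspace])

lemma N_decompose:
  assumes "isolates i h" "x \<in> N"
  obtains m c where "\<And>n. c n \<in> piece i h n" "x = lsum m c"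
  using N_graded[OF assms] that unfolding graded_def by blast

text \<open>Dividing the component of degree \<open>n\<close> by \<open>n\<close> gives a
  preimage.\<close>

lemma ad_surj_on_N:
  assumes h: "isolates i h" and x: "x \<in> N"
  obtains y where "y \<in> N" "\<lbrace>\<iota> h,y\<rbrace> = x"
proof -
  obtain m c where c: "\<And>n. c n \<in> piece i h n" "x = lsum m c" using N_decompose[OF h x] by blast
  note [simp] = c(1)[THEN piece_carr] c(1)[THEN piece_eigen]
  \<comment> \<open>At \<open>n\<close> = 0 the inverse is 0, which is harmless because the
    component of degree 0 vanishes.\<close>
  let ?c = "\<lambda>n. inverse (of_nat n) \<odot> c n"
  have "of_nat n \<odot> ?c n = c n" for n
    using c(1)[of n] by (cases "n = 0") (auto simp: piece_def smul_smul smul_one)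
  then have "\<lbrace>\<iota> h,lsum m ?c\<rbrace> = x"
    using c linear_op_lsum[OF linear_op_brk, of "\<iota> h" ?c m]
    by (simp add: c(1)[THEN piece_smul, THEN piece_eigen])
  moreover have "lsum m ?c \<in> N"
    using c(1) by (auto intro!: lsum_in_subspace[OF N_subspace] N_smul intro: piece_N)
  ultimately show ?thesis using that by blast
qed

text \<open>The components of the image are \<open>n\<close> times those of \<open>x\<close>.
  Independence of eigenvectors makes each of them zero, and in positive degree the factor is nonzero
  in characteristic 0.\<close>

lemma ad_inj_on_N:
  assumes h: "isolates i h" and x: "x \<in> N" and 0: "\<lbrace>\<iota> h,x\<rbrace> = \<zero>"
  shows "x = \<zero>"
proof -
  obtain m c where c: "\<And>n. c n \<in> piece i h n" "x = lsum m c" using N_decompose[OF h x] by blast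
  note [simp] = c(1)[THEN piece_carr] c(1)[THEN piece_eigen]
  have "lsum m (\<lambda>n. of_nat n \<odot> c n) = \<lbrace>\<iota> h,x\<rbrace>"
    unfolding c(2) using c(1) by (subst linear_op_lsum[OF linear_op_brk]) (simp_all add: piece_eigen)
  then have "lsum m (\<lambda>n. of_nat n \<odot> c n) \<in> {\<zero>}" using 0 by simp
  then have *: "of_nat n \<odot> c n \<in> {\<zero>}" if "n < m" for n
    using that c(1)
    by (intro eigenvector_components[OF subspace_trivial linear_op_brk, where \<mu> = of_nat and m = m
          and c = "\<lambda>n. of_nat n \<odot> c n", of "\<iota> h"])
      (auto simp: brk_smul_right inj_def)
  have "c n = \<zero>" if "n < m" for n
    using *[OF that] c(1)[of n] by (cases "n = 0") (auto simp: smul_eq_zer piece_def)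
  then have "lsum m c \<in> {\<zero>}"
    by (intro lsum_in_subspace[OF subspace_trivial]) auto
  then show ?thesis using c(2) by simp
qed

text \<open>Applying \<open>ad h\<close> - 1 to \<open>x\<close> gives a multiple of
  \<open>e i\<close>, so each component times \<open>n\<close> - 1 lies on the line; degree 1 is
  settled by the definition of \<open>piece\<close>. The inhomogeneous term is there because the
  image of \<open>e i\<close> under a derivation at first satisfies only such an equation.\<close>

lemma root_line:
  assumes h: "isolates i h" and x: "x \<in> N" and eq: "\<lbrace>\<iota> h,x\<rbrace> = x \<oplus> a \<odot> e i"
  shows "x \<in> line i"
proof -
  let ?J = "line i"
  note J = line_subspace[of i]
  have ad_J: "\<lbrace>\<iota> h,y\<rbrace> \<in> ?J" if "y \<in> ?J" for y
    using that by (auto simp: line_def brk_smul_right \<iota>_e smul_smul)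
  obtain m c where c: "\<And>n. c n \<in> piece i h n" "x = lsum m c" using N_decompose[OF h x] by blast
  note [simp] = c(1)[THEN piece_carr] c(1)[THEN piece_eigen]
  let ?T = "\<lambda>x. \<lbrace>\<iota> h,x\<rbrace> \<oplus> (-1) \<odot> x"
  have T: "linear_op ?T"
    by (intro linear_op_add linear_op_brk linear_op_smul) simp
  have Tc: "?T (c n) = (of_nat n - 1) \<odot> c n" for n
    using c(1)[of n] by (simp add: piece_eigen smul_add_left[symmetric])
  have "?T x = a \<odot> e i"
    using x eq by (intro eq_diff_iff[THEN iffD2, symmetric]) (simp_all add: add_comm)
  moreover have "?T x = lsum m (\<lambda>n. (of_nat n - 1) \<odot> c n)"
    unfolding c(2) by (subst linear_op_lsum[OF T]) (simp_all only: Tc c(1)[THEN piece_carr])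
  ultimately have "lsum m (\<lambda>n. (of_nat n - 1) \<odot> c n) \<in> ?J"
    using subspace_smul[OF J e_line] by metis
  then have *: "(of_nat n - 1) \<odot> c n \<in> ?J" if "n < m" for n
    using that c(1)
    by (intro eigenvector_components[OF J linear_op_brk, where \<mu> = of_nat and m = m
          and c = "\<lambda>n. (of_nat n - 1) \<odot> c n", of "\<iota> h"])
      (auto simp: brk_smul_right inj_def smul_smul mult.commute ad_J)
  have "c n \<in> ?J" if "n < m" for n
  proof (cases "n = 1")
    case False
    then have "(of_nat n - 1 :: 'f) \<noteq> 0" by (metis eq_iff_diff_eq_0 of_nat_1 of_nat_eq_iff)
    then show ?thesis using *[OF that] subspace_smulD[OF J] c(1) piece_carr by blast
  qed (use c(1)[of 1] in \<open>simp add: piece_def\<close>)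
  then show ?thesis unfolding c(2) by (rule lsum_in_subspace[OF J])
qed

end

section \<open>Derivations of a Borel subalgebra\<close>

text \<open>The two nondegeneracy conditions added here are what the representation on words and the
  choice of the radical have to provide.\<close>

locale borel_data = half_borel L sc \<alpha> \<iota> e + cartan: vector_space sc
  for L :: "('f::field_char_0, 'a) lie_struct"
    and sc :: "'f \<Rightarrow> 'h::ab_group_add \<Rightarrow> 'h"
    and \<alpha> :: "'i \<Rightarrow> 'h \<Rightarrow> 'f" and \<iota> e +
  assumes \<iota>_inj: "\<iota> h = \<zero> \<Longrightarrow> h = 0"
    and e_nonzero: "e i \<noteq> \<zero>"
begin

lemma \<iota>_zero [simp]: "\<iota> 0 = \<zero>"
  using \<iota>_smul[of 0 0] by simp

lemma \<iota>_eq_iff: "\<iota> h = \<iota> h' \<longleftrightarrow> h = h'"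
proof
  assume "\<iota> h = \<iota> h'"
  then have "\<iota> (h + sc (-1) h') = \<zero>"
    unfolding \<iota>_add \<iota>_smul by (simp add: add_neg)
  then show "h = h'" using \<iota>_inj by fastforce
qed simp

lemma smul_e_eq_iff: "c \<odot> e i = d \<odot> e i \<longleftrightarrow> c = d"
proof
  assume "c \<odot> e i = d \<odot> e i"
  then have "c \<odot> e i \<oplus> (-1) \<odot> d \<odot> e i = \<zero>" by (subst diff_eq_zer_iff) simp_all
  then have "(c + - d) \<odot> e i = \<zero>" by (subst smul_add_left) (simp_all add: smul_smul)
  then show "c = d" using e_nonzero by (simp add: smul_eq_zer)
qed simp

section \<open>Cartan and nilpotent components\<close>

lemma carr_B: "x \<in> carr B \<longleftrightarrow> (\<exists>h n. n \<in> N \<and> x = \<iota> h \<oplus> n)"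
  by (auto simp: borel_def sum_set_def)

lemma ops_B [simp]:
  "add B = add L" "zer B = zer L" "smul B = smul L" "brk B = brk L"
  by (simp_all add: borel_def)

lemma B_subset [simp]: "x \<in> carr B \<Longrightarrow> x \<in> carr L"
  by (auto simp: carr_B)

lemma N_subset_B [simp]: "n \<in> N \<Longrightarrow> n \<in> carr B"
  unfolding carr_B by (metis N_carr \<iota>_zero zer_add)

lemma H_subset_B [simp]: "\<iota> h \<in> carr B"
  unfolding carr_B by (metis N_zer \<iota>_closed add_zer)

lemma B_add [simp]: assumes "x \<in> carr B" "y \<in> carr B" shows "x \<oplus> y \<in> carr B"
proof -
  obtain h n h' n' where "n \<in> N" "x = \<iota> h \<oplus> n" "n' \<in> N" "y = \<iota> h' \<oplus> n'"
    using assms carr_B by metis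
  then have "x \<oplus> y = \<iota> (h + h') \<oplus> (n \<oplus> n')" "n \<oplus> n' \<in> N"
    by (simp_all add: add_ac \<iota>_add)
  then show ?thesis using carr_B by blast
qed

lemma B_smul [simp]: assumes "x \<in> carr B" shows "c \<odot> x \<in> carr B"
proof -
  obtain h n where "n \<in> N" "x = \<iota> h \<oplus> n" using assms carr_B by metis
  then have "c \<odot> x = \<iota> (sc c h) \<oplus> c \<odot> n" "c \<odot> n \<in> N"
    by (simp_all add: smul_add_right \<iota>_smul)
  then show ?thesis using carr_B by blast
qed

lemma B_brk_N: assumes "x \<in> carr B" "y \<in> carr B" shows "\<lbrace>x,y\<rbrace> \<in> N"
  using assms by (auto simp: carr_B brk_add_left brk_add_right)

lemma B_brk [simp]: "x \<in> carr B \<Longrightarrow> y \<in> carr B \<Longrightarrow> \<lbrace>x,y\<rbrace> \<in> carr B"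
  using B_brk_N N_subset_B by blast

lemma B_zer [simp]: "\<zero> \<in> carr B" by simp

text \<open>Applying \<open>ad h0\<close> kills the Cartan parts and is injective on
  \<open>N\<close>, so the nilpotent parts agree first.\<close>

lemma B_unique:
  assumes "n \<in> N" "n' \<in> N" "\<iota> h \<oplus> n = \<iota> h' \<oplus> n'"
  shows "h = h' \<and> n = n'"
proof -
  \<comment> \<open>Any index will do, so \<open>undefined\<close> is a harmless choice.\<close>
  obtain h0 where h0: "isolates undefined h0" using ex_isolates by blast
  have "\<lbrace>\<iota> h0,\<iota> h \<oplus> n\<rbrace> = \<lbrace>\<iota> h0,\<iota> h' \<oplus> n'\<rbrace>" using assms by simp
  then have "\<lbrace>\<iota> h0,n\<rbrace> = \<lbrace>\<iota> h0,n'\<rbrace>" using assms(1,2) by (simp add: brk_add_right)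
  then have "\<lbrace>\<iota> h0,n \<oplus> (-1) \<odot> n'\<rbrace> = \<zero>"
    using assms(1,2) by (simp add: brk_add_right brk_smul_right add_neg)
  then have "n \<oplus> (-1) \<odot> n' = \<zero>" using ad_inj_on_N[OF h0] assms(1,2) by simp
  then have "n = n'" using assms(1,2) by (simp add: diff_eq_zer_iff)
  moreover from this have "\<iota> h = \<iota> h'"
    using assms by (metis N_carr \<iota>_closed add_cancel add_comm)
  ultimately show ?thesis by (simp add: \<iota>_eq_iff)
qed

section \<open>Structure of a derivation\<close>

lemma cartan_linearI:
  assumes "\<And>h h'. \<phi> (h + h') = \<phi> h + \<phi> h'" "\<And>c h. \<phi> (sc c h) = sc c (\<phi> h)"
  shows "Vector_Spaces.linear sc sc \<phi>"
  using assms by unfold_locales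

text \<open>The derivation property on the carrier alone, without extensionality, so that inner
  corrections can be added without restricting maps.\<close>

definition deriv :: "('a \<Rightarrow> 'a) \<Rightarrow> bool" where
  "deriv D \<longleftrightarrow> (\<forall>x\<in>carr B. D x \<in> carr B) \<and>
     (\<forall>x\<in>carr B. \<forall>y\<in>carr B. D (x \<oplus> y) = D x \<oplus> D y) \<and>
     (\<forall>c. \<forall>x\<in>carr B. D (c \<odot> x) = c \<odot> D x) \<and>
     (\<forall>x\<in>carr B. \<forall>y\<in>carr B. D \<lbrace>x,y\<rbrace> = \<lbrace>D x,y\<rbrace> \<oplus> \<lbrace>x,D y\<rbrace>)"

lemma carr_Der: "D \<in> carr (Der B) \<longleftrightarrow> D \<in> extensional (carr B) \<and> deriv D"
  by (auto simp: Der_def deriv_def PiE_def)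

lemma deriv_brk: "z \<in> carr B \<Longrightarrow> deriv (brk L z)"
  by (simp add: deriv_def brk_add_right brk_smul_right jacobi_left[of z])

lemma deriv_add: "deriv D \<Longrightarrow> deriv D' \<Longrightarrow> deriv (\<lambda>x. D x \<oplus> D' x)"
  unfolding deriv_def
  by (auto simp: smul_add_right brk_add_left brk_add_right add_ac)

lemma deriv_cong: "deriv D \<Longrightarrow> (\<And>x. x \<in> carr B \<Longrightarrow> D' x = D x) \<Longrightarrow> deriv D'"
  by (simp add: deriv_def)

lemma derivD:
  assumes "deriv D"
  shows "x \<in> carr B \<Longrightarrow> D x \<in> carr B"
    and "x \<in> carr B \<Longrightarrow> y \<in> carr B \<Longrightarrow> D (x \<oplus> y) = D x \<oplus> D y"
    and "x \<in> carr B \<Longrightarrow> D (c \<odot> x) = c \<odot> D x"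
    and "x \<in> carr B \<Longrightarrow> y \<in> carr B \<Longrightarrow> D \<lbrace>x,y\<rbrace> = \<lbrace>D x,y\<rbrace> \<oplus> \<lbrace>x,D y\<rbrace>"
    and "D \<zero> = \<zero>"
proof -
  have "D (0 \<odot> \<zero>) = 0 \<odot> D \<zero>" "D \<zero> \<in> carr B" using assms B_zer unfolding deriv_def by blast+
  then show "D \<zero> = \<zero>" by simp
qed (use assms in \<open>simp_all add: deriv_def\<close>)

lemma deriv_eq_on_N:
  assumes D: "deriv D" and D': "deriv D'" and e: "\<And>i. D (e i) = D' (e i)" and x: "x \<in> N"
  shows "D x = D' x"
  using x by (induction rule: N_induct) (simp_all add: e derivD[OF D] derivD[OF D'])

lemma deriv_diagonal:
  assumes D: "deriv D" and h0: "isolates i0 h0" and t: "D (\<iota> h0) = \<iota> t"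
  shows "\<exists>\<phi> c. Vector_Spaces.linear sc sc \<phi> \<and> (\<forall>h. D (\<iota> h) = \<iota> (\<phi> h)) \<and>
    (\<forall>i. D (e i) = c i \<odot> e i) \<and> (\<forall>i h. \<alpha> i (\<phi> h) = 0)"
proof -
  note DD = derivD[OF D]
  have "\<exists>a. D (\<iota> h) = \<iota> a" for h
  proof -
    obtain a n where n: "n \<in> N" "D (\<iota> h) = \<iota> a \<oplus> n" using DD(1) carr_B H_subset_B by metis
    \<comment> \<open>\<open>D\<close> is applied to [h, h0] = 0. The Cartan parts commute with
      \<open>H\<close>, so only the nilpotent part \<open>n\<close> contributes, and
      \<open>ad h0\<close> is injective on it.\<close>
    have "\<lbrace>D (\<iota> h),\<iota> h0\<rbrace> \<oplus> \<lbrace>\<iota> h,D (\<iota> h0)\<rbrace> = \<zero>"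
      using DD(4)[of "\<iota> h" "\<iota> h0"] DD(5) by simp
    then have "\<lbrace>n,\<iota> h0\<rbrace> = \<zero>"
      using n(1) unfolding n(2) t by (simp add: brk_add_left)
    then have "\<lbrace>\<iota> h0,n\<rbrace> = \<zero>"
      using n(1) brk_swap[of n "\<iota> h0"] by simp
    then have "n = \<zero>" using ad_inj_on_N[OF h0] n(1) by blast
    then show ?thesis using n(2) by auto
  qed
  then obtain \<phi> where \<phi>: "\<And>h. D (\<iota> h) = \<iota> (\<phi> h)" by metis
  have lin: "Vector_Spaces.linear sc sc \<phi>"
  proof (rule cartan_linearI)
    show "\<phi> (h + h') = \<phi> h + \<phi> h'" for h h'
      using DD(2)[of "\<iota> h" "\<iota> h'"] by (simp add: \<phi> \<iota>_add[symmetric] \<iota>_eq_iff)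
    show "\<phi> (sc c h) = sc c (\<phi> h)" for c h
      using DD(3)[of "\<iota> h" c] by (simp add: \<phi> \<iota>_smul[symmetric] \<iota>_eq_iff)
  qed
  have De: "D (\<alpha> i h \<odot> e i) = \<alpha> i (\<phi> h) \<odot> e i \<oplus> \<lbrace>\<iota> h,D (e i)\<rbrace>" for i h
    using DD(4)[of "\<iota> h" "e i"] by (simp add: \<phi> \<iota>_e)
  have "\<exists>c. D (e i) = c \<odot> e i" for i
  proof -
    obtain h where h: "isolates i h" using ex_isolates by blast
    obtain a n where n: "n \<in> N" "D (e i) = \<iota> a \<oplus> n" using DD(1) carr_B e_in_N N_subset_B by metis
    \<comment> \<open>Since \<alpha> i h = 1, the Leibniz rule for [h, e_i] becomes an equation for
      \<open>D (e i)\<close>, whose Cartan and nilpotent components are compared separately.\<close>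
    have "\<iota> a \<oplus> n = \<alpha> i (\<phi> h) \<odot> e i \<oplus> \<lbrace>\<iota> h,D (e i)\<rbrace>"
      using De[of i h] h by (simp add: isolates_def smul_one n(2))
    also have "\<dots> = \<iota> 0 \<oplus> (\<alpha> i (\<phi> h) \<odot> e i \<oplus> \<lbrace>\<iota> h,n\<rbrace>)"
      using n(1) by (simp add: n(2) brk_add_right)
    finally have "a = 0 \<and> n = \<alpha> i (\<phi> h) \<odot> e i \<oplus> \<lbrace>\<iota> h,n\<rbrace>"
      using n(1) by (intro B_unique) simp_all
    then have a: "a = 0" and eq: "\<lbrace>\<iota> h,n\<rbrace> \<oplus> \<alpha> i (\<phi> h) \<odot> e i = n"
      using n(1) by (simp_all add: add_comm)
    have "\<lbrace>\<iota> h,n\<rbrace> = n \<oplus> (-1) \<odot> (\<alpha> i (\<phi> h) \<odot> e i)"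
      using n(1) eq by (subst eq_diff_iff) simp_all
    then have "n \<in> line i" using n(1) by (intro root_line[OF h]) (simp_all add: smul_smul)
    then show ?thesis using n a by (auto simp: line_def)
  qed
  then obtain c where c: "\<And>i. D (e i) = c i \<odot> e i" by metis
  have "\<alpha> i (\<phi> h) = 0" for i h
  proof -
    \<comment> \<open>The Leibniz rule is used again, now for arbitrary \<open>h\<close>: as
      \<open>D (e i)\<close> is a multiple of \<open>e i\<close>, the two terms
      \<open>\<alpha> i h * c i\<close> cancel.\<close>
    have "(\<alpha> i h * c i) \<odot> e i = (\<alpha> i (\<phi> h) + \<alpha> i h * c i) \<odot> e i"
      using De[of i h] by (simp add: DD(3) c brk_smul_right \<iota>_e smul_smul smul_add_left mult.commute)
    then show ?thesis by (simp add: smul_e_eq_iff)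
  qed
  then show ?thesis using lin \<phi> c by blast
qed

lemma deriv_structure:
  assumes D: "deriv D"
  shows "\<exists>\<phi> z. Vector_Spaces.linear sc sc \<phi> \<and> range \<phi> \<subseteq> cartan_center \<alpha> \<and> z \<in> carr B \<and>
    (\<forall>h. \<forall>x\<in>N. D (\<iota> h \<oplus> x) = \<iota> (\<phi> h) \<oplus> \<lbrace>z,\<iota> h \<oplus> x\<rbrace>)"
proof -
  obtain h0 where h0: "isolates undefined h0" using ex_isolates by blast
  obtain t x where x: "x \<in> N" "D (\<iota> h0) = \<iota> t \<oplus> x" using derivD(1)[OF D] carr_B H_subset_B by metis
  \<comment> \<open>With this \<open>y\<close>, [y, h0] = -x, so adding \<open>ad y\<close> cancels
    the nilpotent part of \<open>D h0\<close>.\<close>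
  obtain y where y: "y \<in> N" "\<lbrace>\<iota> h0,y\<rbrace> = x" using ad_surj_on_N[OF h0 x(1)] by blast
  let ?D = "\<lambda>u. D u \<oplus> \<lbrace>y,u\<rbrace>"
  have D': "deriv ?D" using D y(1) by (intro deriv_add deriv_brk) simp_all
  have "?D (\<iota> h0) = \<iota> t \<oplus> (x \<oplus> (-1) \<odot> x)"
    using x y brk_swap[of "\<iota> h0" y] by (simp add: add_assoc)
  then have "?D (\<iota> h0) = \<iota> t" using x(1) by (simp add: add_neg)
  from deriv_diagonal[OF D' h0 this] obtain \<phi> c
    where \<phi>: "Vector_Spaces.linear sc sc \<phi>" "\<And>h. ?D (\<iota> h) = \<iota> (\<phi> h)" "\<And>i h. \<alpha> i (\<phi> h) = 0"
      and c: "\<And>i. ?D (e i) = c i \<odot> e i" by blast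
  obtain s where s: "\<And>i. \<alpha> i s = c i" using roots_separate by blast
  \<comment> \<open>\<open>ad s\<close> accounts for the diagonal action on the generators, and -y
    undoes the correction by \<open>ad y\<close>.\<close>
  define z where "z = \<iota> s \<oplus> (-1) \<odot> y"
  have z: "z \<in> carr B" using y(1) by (simp add: z_def)
  have eqD: "D u = ?D u \<oplus> (-1) \<odot> \<lbrace>y,u\<rbrace>" if "u \<in> carr B" for u
    using that y(1) derivD(1)[OF D] by (subst eq_diff_iff) simp_all
  have brz: "\<lbrace>z,u\<rbrace> = \<lbrace>\<iota> s,u\<rbrace> \<oplus> (-1) \<odot> \<lbrace>y,u\<rbrace>" if "u \<in> carr B" for u
    using that y(1) by (simp add: z_def brk_add_left brk_smul_left)
  have "D (e i) = \<lbrace>z,e i\<rbrace>" for i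
    using eqD[of "e i", unfolded c] brz[of "e i"] by (simp add: \<iota>_e s)
  then have DN: "D x = \<lbrace>z,x\<rbrace>" if "x \<in> N" for x
    using deriv_eq_on_N[OF D deriv_brk[OF z]] that by blast
  have DH: "D (\<iota> h) = \<iota> (\<phi> h) \<oplus> \<lbrace>z,\<iota> h\<rbrace>" for h
    using eqD[of "\<iota> h", unfolded \<phi>] brz[of "\<iota> h"] y(1) by simp
  have "D (\<iota> h \<oplus> x) = \<iota> (\<phi> h) \<oplus> \<lbrace>z,\<iota> h \<oplus> x\<rbrace>" if "x \<in> N" for h x
    using that z by (simp add: derivD(2)[OF D] DH DN brk_add_right add_assoc)
  then show ?thesis using \<phi>(1,3) z by (auto simp: cartan_center_def intro!: exI[of _ \<phi>] exI[of _ z])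
qed

lemma cartan_center_N: "c \<in> cartan_center \<alpha> \<Longrightarrow> x \<in> N \<Longrightarrow> \<lbrace>\<iota> c,x\<rbrace> = \<zero>"
  by (rotate_tac 1, induction rule: N_induct)
    (simp_all add: \<iota>_e cartan_center_def brk_add_right brk_smul_right jacobi_left[of "\<iota> c"])

lemma cartan_center_B: "c \<in> cartan_center \<alpha> \<Longrightarrow> x \<in> carr B \<Longrightarrow> \<lbrace>\<iota> c,x\<rbrace> = \<zero>"
  by (auto simp: carr_B brk_add_right cartan_center_N)

section \<open>The two summands and the decomposition\<close>

abbreviation "hom_c \<equiv> hom_cartan_center sc \<alpha> L \<iota> e"

text \<open>Such a map kills \<open>N\<close>, which contains all brackets, and its values are
  central, so both sides of the Leibniz rule vanish.\<close>

lemma hom_c_deriv: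
  assumes "D \<in> hom_c" shows "deriv D"
proof -
  obtain \<phi> where \<phi>: "Vector_Spaces.linear sc sc \<phi>" "range \<phi> \<subseteq> cartan_center \<alpha>"
    "\<And>h x. x \<in> N \<Longrightarrow> D (\<iota> h \<oplus> x) = \<iota> (\<phi> h)"
    using assms unfolding hom_cartan_center_def by blast
  interpret \<phi>: Vector_Spaces.linear sc sc \<phi> by fact
  have DB: "\<exists>c \<in> cartan_center \<alpha>. D x = \<iota> c" if "x \<in> carr B" for x
    using that \<phi>(2,3) by (fastforce simp: carr_B)
  have DN: "D x = \<zero>" if "x \<in> N" for x
    using \<phi>(3)[OF that, of 0] that by (simp add: \<phi>.zero)
  show ?thesis unfolding deriv_def
  proof (intro conjI ballI allI)
    fix x y assume xy: "x \<in> carr B" "y \<in> carr B"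
    then obtain h n h' n' where *: "n \<in> N" "x = \<iota> h \<oplus> n" "n' \<in> N" "y = \<iota> h' \<oplus> n'"
      by (auto simp: carr_B)
    then have "x \<oplus> y = \<iota> (h + h') \<oplus> (n \<oplus> n')" by (simp add: add_ac \<iota>_add)
    then have "D (x \<oplus> y) = \<iota> (\<phi> (h + h'))" using * \<phi>(3)[of "n \<oplus> n'" "h + h'"] by simp
    then show "D (x \<oplus> y) = D x \<oplus> D y" using * by (simp add: \<phi>(3) \<phi>.add \<iota>_add)
    have "\<lbrace>D x,y\<rbrace> = \<zero>" using DB[OF xy(1)] xy cartan_center_B by auto
    moreover have "\<lbrace>x,D y\<rbrace> = \<zero>"
      using DB[OF xy(2)] xy cartan_center_B brk_swap[of _ x] by fastforce
    ultimately show "D \<lbrace>x,y\<rbrace> = \<lbrace>D x,y\<rbrace> \<oplus> \<lbrace>x,D y\<rbrace>"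
      using DN B_brk_N[OF xy] by simp
  next
    fix c x assume "x \<in> carr B"
    then obtain h n where *: "n \<in> N" "x = \<iota> h \<oplus> n" by (auto simp: carr_B)
    then have "c \<odot> x = \<iota> (sc c h) \<oplus> c \<odot> n" by (simp add: smul_add_right \<iota>_smul)
    then have "D (c \<odot> x) = \<iota> (\<phi> (sc c h))" using * \<phi>(3)[of "c \<odot> n" "sc c h"] by simp
    then show "D (c \<odot> x) = c \<odot> D x" using * by (simp add: \<phi>(3) \<phi>.scale \<iota>_smul)
  qed (use DB in fastforce)
qed

text \<open>Linearity of the roots is derived from the action of \<open>H\<close> on the nonzero
  vectors \<open>e i\<close>, whose eigenvalues depend linearly on \<open>h\<close>.\<close>

lemma root_zero: "\<alpha> i 0 = 0"
  using \<iota>_e[of 0 i, symmetric] by (simp add: smul_eq_zer e_nonzero)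

lemma root_add: "\<alpha> i (h + h') = \<alpha> i h + \<alpha> i h'"
  using \<iota>_e[of "h + h'" i]
  by (simp add: \<iota>_add brk_add_left \<iota>_e smul_add_left[symmetric] smul_e_eq_iff)

lemma root_smul: "\<alpha> i (sc c h) = c * \<alpha> i h"
  using \<iota>_e[of "sc c h" i]
  by (simp add: \<iota>_smul brk_smul_left \<iota>_e smul_smul smul_e_eq_iff)

lemma ops_Der:
  "zer (Der B) = restrict (\<lambda>x. \<zero>) (carr B)"
  "add (Der B) D D' = restrict (\<lambda>x. D x \<oplus> D' x) (carr B)"
  "smul (Der B) c D = restrict (\<lambda>x. c \<odot> D x) (carr B)"
  by (simp_all add: Der_def)

lemma hom_cI:
  assumes "Vector_Spaces.linear sc sc \<phi>" "\<And>h. \<phi> h \<in> cartan_center \<alpha>"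
    and "\<And>h x. x \<in> N \<Longrightarrow> D (\<iota> h \<oplus> x) = \<iota> (\<phi> h)"
  shows "restrict D (carr B) \<in> hom_c"
proof -
  have "\<iota> h \<oplus> x \<in> carr B" if "x \<in> N" for h x using that by simp
  then show ?thesis using assms unfolding hom_cartan_center_def by auto
qed

lemma hom_cE:
  assumes "D \<in> hom_c"
  obtains \<phi> where "Vector_Spaces.linear sc sc \<phi>" "\<And>h. \<phi> h \<in> cartan_center \<alpha>"
    "\<And>h x. x \<in> N \<Longrightarrow> D (\<iota> h \<oplus> x) = \<iota> (\<phi> h)"
  using assms unfolding hom_cartan_center_def by auto

lemma hom_c_subspace: "lie_subspace (Der B) hom_c"
  unfolding lie_subspace_def
proof (intro conjI ballI allI subsetI)
  fix D assume "D \<in> hom_c"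
  then show "D \<in> carr (Der B)"
    using hom_c_deriv by (simp add: carr_Der hom_cartan_center_def)
next
  show "zer (Der B) \<in> hom_c"
    unfolding ops_Der
    by (rule hom_cI[of "\<lambda>_. 0"]) (auto intro: cartan_linearI simp: cartan_center_def root_zero)
next
  fix D D' assume D: "D \<in> hom_c" and D': "D' \<in> hom_c"
  obtain \<phi> where
    \<phi>: "Vector_Spaces.linear sc sc \<phi>" "\<And>h. \<phi> h \<in> cartan_center \<alpha>"
    "\<And>h x. x \<in> N \<Longrightarrow> D (\<iota> h \<oplus> x) = \<iota> (\<phi> h)" using hom_cE[OF D] by blast
  obtain \<phi>' where
    \<phi>': "Vector_Spaces.linear sc sc \<phi>'" "\<And>h. \<phi>' h \<in> cartan_center \<alpha>"
    "\<And>h x. x \<in> N \<Longrightarrow> D' (\<iota> h \<oplus> x) = \<iota> (\<phi>' h)" using hom_cE[OF D'] by blast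
  interpret \<phi>: Vector_Spaces.linear sc sc \<phi> by fact
  interpret \<phi>': Vector_Spaces.linear sc sc \<phi>' by fact
  show "add (Der B) D D' \<in> hom_c"
    unfolding ops_Der
  proof (rule hom_cI[of "\<lambda>h. \<phi> h + \<phi>' h"])
    show "Vector_Spaces.linear sc sc (\<lambda>h. \<phi> h + \<phi>' h)"
      by (rule cartan_linearI)
        (simp_all add: \<phi>.add \<phi>'.add \<phi>.scale \<phi>'.scale cartan.scale_right_distrib)
    show "\<phi> h + \<phi>' h \<in> cartan_center \<alpha>" for h
      using \<phi>(2)[of h] \<phi>'(2)[of h] by (simp add: cartan_center_def root_add)
  qed (simp add: \<phi>(3) \<phi>'(3) \<iota>_add)
next
  fix c D assume D: "D \<in> hom_c"
  obtain \<phi> where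
    \<phi>: "Vector_Spaces.linear sc sc \<phi>" "\<And>h. \<phi> h \<in> cartan_center \<alpha>"
    "\<And>h x. x \<in> N \<Longrightarrow> D (\<iota> h \<oplus> x) = \<iota> (\<phi> h)" using hom_cE[OF D] by blast
  interpret \<phi>: Vector_Spaces.linear sc sc \<phi> by fact
  show "smul (Der B) c D \<in> hom_c"
    unfolding ops_Der
  proof (rule hom_cI[of "\<lambda>h. sc c (\<phi> h)"])
    show "Vector_Spaces.linear sc sc (\<lambda>h. sc c (\<phi> h))"
      by (rule cartan_linearI)
        (simp_all add: \<phi>.add \<phi>.scale cartan.scale_right_distrib mult.commute)
    show "sc c (\<phi> h) \<in> cartan_center \<alpha>" for h
      using \<phi>(2)[of h] by (simp add: cartan_center_def root_smul)
  qed (simp add: \<phi>(3) \<iota>_smul)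
qed

lemma ad_map_B: "ad_map B x = restrict (brk L x) (carr B)"
  by (simp add: ad_map_def restrict_def fun_eq_iff)

lemma ad_subspace: "lie_subspace (Der B) (ad_map B ` carr B)"
  unfolding lie_subspace_def
proof (intro conjI ballI allI subsetI)
  fix D assume "D \<in> ad_map B ` carr B"
  then obtain x where x: "x \<in> carr B" "D = restrict (brk L x) (carr B)"
    unfolding ad_map_B by blast
  then have "deriv D" using deriv_cong[OF deriv_brk[OF x(1)], of D] by simp
  then show "D \<in> carr (Der B)" using x by (simp add: carr_Der)
next
  have "zer (Der B) = ad_map B \<zero>"
    unfolding ops_Der ad_map_B by (rule restrict_ext) simp
  then show "zer (Der B) \<in> ad_map B ` carr B" using B_zer by blast
next
  fix D D' assume "D \<in> ad_map B ` carr B" "D' \<in> ad_map B ` carr B"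
  then obtain x y where xy: "x \<in> carr B" "D = ad_map B x" "y \<in> carr B" "D' = ad_map B y" by blast
  then have "add (Der B) D D' = ad_map B (x \<oplus> y)"
    unfolding ops_Der ad_map_B by (intro restrict_ext) (simp add: brk_add_left)
  then show "add (Der B) D D' \<in> ad_map B ` carr B" using B_add[OF xy(1,3)] by blast
next
  fix c D assume "D \<in> ad_map B ` carr B"
  then obtain x where x: "x \<in> carr B" "D = ad_map B x" by blast
  then have "smul (Der B) c D = ad_map B (c \<odot> x)"
    unfolding ops_Der ad_map_B by (intro restrict_ext) (simp add: brk_smul_left)
  then show "smul (Der B) c D \<in> ad_map B ` carr B" using B_smul[OF x(1)] by blast
qed

theorem Der_borel: "is_direct_sum (Der B) hom_c (ad_map B ` carr B)"
  unfolding is_direct_sum_def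
proof (intro conjI hom_c_subspace ad_subspace)
  show "carr (Der B) = sum_set (Der B) hom_c (ad_map B ` carr B)"
  proof (intro equalityI subsetI)
    fix D assume "D \<in> carr (Der B)"
    then have D: "D \<in> extensional (carr B)" "deriv D" by (simp_all add: carr_Der)
    obtain \<phi> z where \<phi>: "Vector_Spaces.linear sc sc \<phi>" "range \<phi> \<subseteq> cartan_center \<alpha>" and z: "z \<in> carr B"
      and eq: "\<And>h x. x \<in> N \<Longrightarrow> D (\<iota> h \<oplus> x) = \<iota> (\<phi> h) \<oplus> \<lbrace>z,\<iota> h \<oplus> x\<rbrace>"
      using deriv_structure[OF D(2)] by blast
    \<comment> \<open>Subtracting the inner part \<open>ad z\<close> leaves the map given by \<phi>
      on \<open>H\<close> and by 0 on \<open>N\<close>.\<close>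
    let ?E = "\<lambda>x. D x \<oplus> (-1) \<odot> \<lbrace>z,x\<rbrace>"
    have "?E (\<iota> h \<oplus> x) = \<iota> (\<phi> h)" if "x \<in> N" for h x
      using that z by (intro eq_diff_iff[THEN iffD2, symmetric]) (simp_all add: eq)
    then have E: "restrict ?E (carr B) \<in> hom_c"
      using \<phi> by (intro hom_cI[of \<phi>]) auto
    have "D x = add (Der B) (restrict ?E (carr B)) (ad_map B z) x" for x
    proof (cases "x \<in> carr B")
      case True
      then show ?thesis using z derivD(1)[OF D(2) True]
        by (simp add: ops_Der ad_map_B add_assoc) (simp add: add_comm[of "(-1) \<odot> _"] add_neg)
    next
      case False
      then show ?thesis using D(1) by (simp add: ops_Der extensional_def)
    qed
    then show "D \<in> sum_set (Der B) hom_c (ad_map B ` carr B)"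
      using E z unfolding sum_set_def by blast
  next
    fix D assume "D \<in> sum_set (Der B) hom_c (ad_map B ` carr B)"
    then obtain D1 D2 where D12: "D = add (Der B) D1 D2" "D1 \<in> hom_c" "D2 \<in> ad_map B ` carr B"
      unfolding sum_set_def by blast
    moreover have "hom_c \<subseteq> carr (Der B)" "ad_map B ` carr B \<subseteq> carr (Der B)"
      using hom_c_subspace ad_subspace by (simp_all add: lie_subspace_def)
    ultimately have "D1 \<in> carr (Der B)" "D2 \<in> carr (Der B)" by auto
    then have "deriv D1" "deriv D2" by (simp_all add: carr_Der)
    then have "deriv D" unfolding D12 ops_Der
      by (rule deriv_cong[OF deriv_add[of D1 D2]]) simp_all
    then show "D \<in> carr (Der B)" unfolding carr_Der D12 ops_Der by simp
  qed
  show "hom_c \<inter> ad_map B ` carr B = {zer (Der B)}"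
  proof (intro equalityI subsetI)
    fix D assume "D \<in> hom_c \<inter> ad_map B ` carr B"
    then obtain \<phi> z where \<phi>: "Vector_Spaces.linear sc sc \<phi>"
      "\<And>h x. x \<in> N \<Longrightarrow> D (\<iota> h \<oplus> x) = \<iota> (\<phi> h)" and z: "z \<in> carr B" "D = ad_map B z"
      unfolding hom_cartan_center_def by blast
    have "D u = \<zero>" if u: "u \<in> carr B" for u
    proof -
      obtain h n where hn: "n \<in> N" "u = \<iota> h \<oplus> n" using u carr_B by metis
      have "D u = \<lbrace>z,u\<rbrace>" using z u by (simp add: ad_map_B)
      \<comment> \<open>One side lies in \<open>H\<close>, the other is a bracket and lies in
        \<open>N\<close>, so both vanish.\<close>
      then have "\<iota> (\<phi> h) \<oplus> \<zero> = \<iota> 0 \<oplus> \<lbrace>z,u\<rbrace>"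
        using hn z u \<phi>(2)[OF hn(1)] by simp
      then have "\<phi> h = 0 \<and> \<zero> = \<lbrace>z,u\<rbrace>"
        using B_brk_N[OF z(1) u] by (intro B_unique) simp_all
      then show ?thesis using \<open>D u = \<lbrace>z,u\<rbrace>\<close> by simp
    qed
    then have "D = zer (Der B)" unfolding ops_Der z(2)
      by (intro extensionalityI[of _ "carr B"]) (auto simp: ad_map_B)
    then show "D \<in> {zer (Der B)}" by simp
  next
    fix D assume "D \<in> {zer (Der B)}"
    then show "D \<in> hom_c \<inter> ad_map B ` carr B"
      using hom_c_subspace ad_subspace by (simp add: lie_subspace_def)
  qed
qed

end

section \<open>Quotients by ideals\<close>

locale lie_quotient_setup = lie_algebra L for L :: "('f::field, 'a) lie_struct" +
  fixes J :: "'a set"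
  assumes ideal: "lie_ideal L J"
begin

abbreviation "r \<equiv> ideal_rel L J"
abbreviation "Q \<equiv> lie_quotient L r"

definition proj :: "'a \<Rightarrow> 'a set" where "proj x = r `` {x}"

lemma J_subspace: "lie_subspace L J"
  using ideal by (simp add: lie_ideal_def)

lemmas J_carr = subspace_carr[OF J_subspace]
  and J_zer = subspace_zer[OF J_subspace]
  and J_add = subspace_add[OF J_subspace]
  and J_smul = subspace_smul[OF J_subspace]

lemma J_brk: "x \<in> carr L \<Longrightarrow> y \<in> J \<Longrightarrow> \<lbrace>x,y\<rbrace> \<in> J"
  using ideal by (simp add: lie_ideal_def)

lemma J_brk_left: "x \<in> J \<Longrightarrow> y \<in> carr L \<Longrightarrow> \<lbrace>x,y\<rbrace> \<in> J"
  using J_smul[OF J_brk[of y x], of "-1"] brk_swap[of y x] J_carr by simp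

text \<open>In this form, checking that an operation respects cosets amounts to expanding
  \<open>y \<oplus> j\<close> by linearity and reading off an element of the ideal.\<close>

lemma rel_iff: "(x, y) \<in> r \<longleftrightarrow> x \<in> carr L \<and> y \<in> carr L \<and> (\<exists>j\<in>J. x = y \<oplus> j)"
proof -
  have "x \<oplus> (-1) \<odot> y \<in> J \<longleftrightarrow> (\<exists>j\<in>J. x = y \<oplus> j)" if xy: "x \<in> carr L" "y \<in> carr L"
  proof -
    have "x = y \<oplus> j \<longleftrightarrow> x \<oplus> (-1) \<odot> y = j" if "j \<in> J" for j
      using xy J_carr[OF that] eq_diff_iff[of j y x] by (auto simp: add_comm)
    then show ?thesis by auto
  qed
  then show ?thesis by (auto simp: ideal_rel_def)
qed

text \<open>As an introduction rule this finds the witness by unification: it remains to show that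
  the term added to \<open>x\<close> lies in \<open>J\<close>.\<close>

lemma rel_exI: "j \<in> J \<Longrightarrow> \<exists>j'\<in>J. x \<oplus> j = x \<oplus> j'"
  by blast

lemma equiv_rel: "equiv (carr L) r"
proof (rule equivI)
  show "r \<subseteq> carr L \<times> carr L" by (auto simp: rel_iff)
  show "refl_on (carr L) r"
    by (auto simp: refl_on_def rel_iff intro!: bexI[OF _ J_zer])
  show "sym r"
  proof (rule symI)
    fix x y assume "(x, y) \<in> r"
    then obtain j where j: "x \<in> carr L" "y \<in> carr L" "j \<in> J" "x = y \<oplus> j" by (auto simp: rel_iff)
    then have "y = x \<oplus> (-1) \<odot> j" using J_carr by (intro eq_diff_iff[THEN iffD2]) simp_all
    then show "(y, x) \<in> r" using j J_smul by (auto simp: rel_iff)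
  qed
  show "trans r"
  proof (rule transI)
    fix x y z assume "(x, y) \<in> r" "(y, z) \<in> r"
    then obtain j j' where "x \<in> carr L" "y \<in> carr L" "z \<in> carr L" "j \<in> J" "j' \<in> J" "x = y \<oplus> j" "y = z \<oplus> j'"
      by (auto simp: rel_iff)
    then show "(x, z) \<in> r"
      using J_carr J_add by (auto simp: rel_iff add_assoc intro!: bexI[of _ "j' \<oplus> j"])
  qed
qed

lemma proj_eq_iff:
  "x \<in> carr L \<Longrightarrow> y \<in> carr L \<Longrightarrow> proj x = proj y \<longleftrightarrow> (\<exists>j\<in>J. x = y \<oplus> j)"
  using eq_equiv_class_iff[OF equiv_rel, of x y] by (simp add: proj_def rel_iff)

lemma proj_zer_iff: "x \<in> carr L \<Longrightarrow> proj x = proj \<zero> \<longleftrightarrow> x \<in> J"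
  using J_carr by (auto simp: proj_eq_iff)

lemma carr_Q: "carr Q = proj ` carr L"
  by (auto simp: lie_quotient_def quotient_def proj_def)

lemma zer_Q: "zer Q = proj \<zero>"
  by (simp add: lie_quotient_def proj_def)

lemma add_Q: assumes "x \<in> carr L" "y \<in> carr L" shows "add Q (proj x) (proj y) = proj (x \<oplus> y)"
proof -
  have "congruent2 r r (\<lambda>x y. r `` {x \<oplus> y})"
  proof (rule congruent2I[OF equiv_rel equiv_rel])
    fix y z w assume "w \<in> carr L" "(y, z) \<in> r"
    then show "r `` {y \<oplus> w} = r `` {z \<oplus> w}" "r `` {w \<oplus> y} = r `` {w \<oplus> z}"
      using J_carr by (auto simp: rel_iff add_ac intro!: equiv_class_eq[OF equiv_rel])
  qed
  from UN_equiv_class2[OF equiv_rel equiv_rel this assms] show ?thesis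
    by (simp add: lie_quotient_def proj_def)
qed

lemma brk_Q: assumes "x \<in> carr L" "y \<in> carr L" shows "brk Q (proj x) (proj y) = proj \<lbrace>x,y\<rbrace>"
proof -
  have "congruent2 r r (\<lambda>x y. r `` {\<lbrace>x,y\<rbrace>})"
  proof (rule congruent2I[OF equiv_rel equiv_rel])
    fix y z w assume "w \<in> carr L" "(y, z) \<in> r"
    then show "r `` {\<lbrace>y,w\<rbrace>} = r `` {\<lbrace>z,w\<rbrace>}" "r `` {\<lbrace>w,y\<rbrace>} = r `` {\<lbrace>w,z\<rbrace>}"
      using J_carr J_brk J_brk_left
      by (auto simp: rel_iff brk_add_left brk_add_right intro!: equiv_class_eq[OF equiv_rel] rel_exI)
  qed
  from UN_equiv_class2[OF equiv_rel equiv_rel this assms] show ?thesis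
    by (simp add: lie_quotient_def proj_def)
qed

lemma smul_Q: assumes "x \<in> carr L" shows "smul Q c (proj x) = proj (c \<odot> x)"
proof -
  have "congruent r (\<lambda>x. r `` {c \<odot> x})"
    using J_carr J_smul
    by (auto simp: rel_iff congruent_def smul_add_right intro!: equiv_class_eq[OF equiv_rel] rel_exI)
  from UN_equiv_class[OF equiv_rel this assms] show ?thesis
    by (simp add: lie_quotient_def proj_def)
qed

lemma lie_algebra_Q: "lie_algebra Q"
  by unfold_locales
    (auto simp: carr_Q zer_Q add_Q brk_Q smul_Q add_assoc add_neg smul_add_right smul_add_left
      smul_smul smul_one brk_add_left brk_add_right brk_smul_left brk_smul_right brk_self jacobi
      intro: arg_cong[where f = proj, OF add_comm] del: equalityI subsetI)

end

text \<open>\<open>ad g\<close> is a derivation by the Jacobi identity, and the Borel subalgebra is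
  closed under brackets. The element \<open>g\<close> may lie outside it; the lemma serves for
  generators of the opposite sign.\<close>

lemma (in borel_data) ad_into_B:
  assumes g: "g \<in> carr L" "\<And>j. \<lbrace>g,e j\<rbrace> \<in> carr B" and x: "x \<in> N"
  shows "\<lbrace>g,x\<rbrace> \<in> carr B"
  using x by (induction rule: N_induct)
    (use g B_zer in \<open>simp_all add: brk_add_right brk_smul_right jacobi_left[of g] del: B_zer\<close>)

section \<open>Triangular decomposition and the greatest ideal avoiding the Cartan subalgebra\<close>

text \<open>With the roots negated, the lowering generators satisfy the axioms of the raising ones,
  so the results on the nilpotent part hold for both halves.\<close>

locale chevalley = lie_algebra L + E: borel_data L sc \<alpha> \<iota> e + F: borel_data L sc "\<lambda>i h. - \<alpha> i h" \<iota> f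
  for L :: "('f::field_char_0, 'a) lie_struct"
    and sc :: "'f \<Rightarrow> 'h::ab_group_add \<Rightarrow> 'h"
    and \<alpha> :: "'i \<Rightarrow> 'h \<Rightarrow> 'f" and \<iota> e f +
  fixes \<alpha>v :: "'i \<Rightarrow> 'h"
  assumes e_f: "\<lbrace>e i,f j\<rbrace> = (if i = j then \<iota> (\<alpha>v i) else \<zero>)"
    and coroot_nonzero: "\<alpha>v i \<noteq> 0"
    and generated: "lie_subalgebra L U \<Longrightarrow> range \<iota> \<union> range e \<union> range f \<subseteq> U \<Longrightarrow> carr L \<subseteq> U"
begin

lemma f_e: "\<lbrace>f j,e i\<rbrace> = (if i = j then \<iota> (sc (-1) (\<alpha>v i)) else \<zero>)"
  by (subst brk_swap[of "e i"]) (simp_all add: e_f E.\<iota>_smul del: E.cartan.scale_minus_left)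

definition tri :: "'a set" where "tri = sum_set L F.N (carr E.B)"

lemma triI: "a \<in> F.N \<Longrightarrow> b \<in> carr E.B \<Longrightarrow> a \<oplus> b \<in> tri"
  by (auto simp: tri_def sum_set_def)

lemma tri_EB: "b \<in> carr E.B \<Longrightarrow> b \<in> tri"
  using triI[OF F.N_zer] by fastforce

lemma tri_FB: "b \<in> carr F.B \<Longrightarrow> b \<in> tri"
  using triI[OF _ E.H_subset_B] by (fastforce simp: F.carr_B add_comm)

lemma tri_subspace: "lie_subspace L tri"
  unfolding lie_subspace_def
proof (intro conjI ballI allI)
  show "tri \<subseteq> carr L" by (auto simp: tri_def sum_set_def)
  show "\<zero> \<in> tri" by (rule tri_EB) simp
next
  fix x y assume "x \<in> tri" "y \<in> tri"
  then obtain a b a' b' where "x = a \<oplus> b" "y = a' \<oplus> b'" "a \<in> F.N" "a' \<in> F.N" "b \<in> carr E.B" "b' \<in> carr E.B"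
    by (auto simp: tri_def sum_set_def)
  moreover from this have "x \<oplus> y = (a \<oplus> a') \<oplus> (b \<oplus> b')" by (simp add: add_ac)
  ultimately show "x \<oplus> y \<in> tri" by (simp add: triI)
next
  fix c x assume "x \<in> tri"
  then obtain a b where "x = a \<oplus> b" "a \<in> F.N" "b \<in> carr E.B"
    by (auto simp: tri_def sum_set_def)
  then show "c \<odot> x \<in> tri" by (simp add: smul_add_right triI)
qed

text \<open>For a generator \<open>x\<close>, \<open>ad x\<close> maps the \<open>f j\<close> into
  the negative Borel subalgebra and the \<open>e j\<close> into the positive one, so
  \<open>ad_into_B\<close> applies on each side.\<close>

lemma tri_stable:
  assumes x: "x \<in> range \<iota> \<union> range e \<union> range f" and s: "s \<in> tri"
  shows "\<lbrace>x,s\<rbrace> \<in> tri"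
proof -
  obtain a h b where s: "s = a \<oplus> (\<iota> h \<oplus> b)" "a \<in> F.N" "b \<in> E.N"
    using s by (auto simp: tri_def sum_set_def E.carr_B)
  have x': "x \<in> carr L" using x by auto
  have "\<lbrace>x,a\<rbrace> \<in> carr F.B"
    by (rule F.ad_into_B[OF x' _ s(2)]) (use x in \<open>auto simp: e_f F.\<iota>_e\<close>)
  moreover have "\<lbrace>x,b\<rbrace> \<in> carr E.B"
    by (rule E.ad_into_B[OF x' _ s(3)]) (use x in \<open>auto simp: f_e E.\<iota>_e\<close>)
  moreover have "\<lbrace>x,\<iota> h\<rbrace> \<in> carr F.B \<or> \<lbrace>x,\<iota> h\<rbrace> \<in> carr E.B"
    using x by auto
  moreover have "\<lbrace>x,s\<rbrace> = \<lbrace>x,a\<rbrace> \<oplus> (\<lbrace>x,\<iota> h\<rbrace> \<oplus> \<lbrace>x,b\<rbrace>)"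
    using x' s by (simp add: brk_add_right)
  ultimately show ?thesis
    using tri_EB tri_FB subspace_add[OF tri_subspace] by metis
qed

text \<open>The elements of \<open>tri\<close> that map \<open>tri\<close> into itself form a
  subalgebra by the Jacobi identity, and it contains the generators.\<close>

lemma carr_tri: "carr L \<subseteq> tri"
proof -
  let ?U = "{x \<in> tri. \<forall>s\<in>tri. \<lbrace>x,s\<rbrace> \<in> tri}"
  note [simp] = subspace_carr[OF tri_subspace]
  have "lie_subalgebra L ?U"
    unfolding lie_subalgebra_def lie_subspace_def
  proof (intro conjI ballI allI)
    fix x y assume "x \<in> ?U" "y \<in> ?U"
    then show "x \<oplus> y \<in> ?U" "\<lbrace>x,y\<rbrace> \<in> ?U"
      by (auto simp: brk_add_left jacobi_right
          intro!: subspace_add[OF tri_subspace] subspace_smul[OF tri_subspace])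
  qed (auto simp: brk_smul_left intro: subspace_zer[OF tri_subspace] subspace_smul[OF tri_subspace])
  moreover have "range \<iota> \<union> range e \<union> range f \<subseteq> ?U"
    using tri_stable tri_EB tri_FB by (auto intro: E.N_subset_B F.N_subset_B)
  ultimately show ?thesis using generated[of ?U] by auto
qed

text \<open>The squared operator merges the opposite eigenvalues \<open>n\<close> and \<open>-n\<close>, so that the eigenvalues are
  again indexed by natural numbers and the Cartan component is the one of index 0.\<close>

lemma cartan_component:
  assumes J: "lie_ideal L J" and x: "a \<oplus> (\<iota> h \<oplus> b) \<in> J" and a: "a \<in> F.N" and b: "b \<in> E.N"
  shows "\<iota> h \<in> J"
proof -
  obtain i :: 'i and h0 where h0: "E.isolates i h0" using E.ex_isolates by blast
  \<comment> \<open>The negated roots take at -h0 the values that the roots take at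
    \<open>h0\<close>, so one element grades both halves.\<close>
  then have h0': "F.isolates i (sc (-1) h0)"
    by (simp add: E.isolates_def F.isolates_def E.root_smul del: E.cartan.scale_minus_left)
  obtain m c where c: "\<And>n. c n \<in> E.piece i h0 n" "b = lsum m c" using E.N_decompose[OF h0 b] by blast
  obtain m' c' where c': "\<And>n. c' n \<in> F.piece i (sc (-1) h0) n" "a = lsum m' c'"
    using F.N_decompose[OF h0' a] by blast
  note [simp] = c(1)[THEN E.piece_carr] c'(1)[THEN F.piece_carr]
  let ?T = "\<lambda>x. \<lbrace>\<iota> h0,\<lbrace>\<iota> h0,x\<rbrace>\<rbrace>"
  have T: "linear_op ?T" by (rule linear_op_comp[OF linear_op_brk linear_op_brk]) simp_all
  have T_J: "?T x \<in> J" if "x \<in> J" for x using that J by (simp add: lie_ideal_def)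
  \<comment> \<open>\<open>d n\<close> collects the degrees \<open>n\<close> and -n. The part of
    index 0 is \<iota> h, because the pieces of degree 0 vanish.\<close>
  define d where "d n = (if n < m' then c' n else \<zero>) \<oplus> ((if n < 1 then \<iota> h else \<zero>) \<oplus> (if n < m then c n else \<zero>))" for n
  have [simp]: "d n \<in> carr L" for n by (simp add: d_def)
  have "\<lbrace>\<iota> h0,c n\<rbrace> = of_nat n \<odot> c n" for n using E.piece_eigen[OF c(1)] .
  then have Tc: "?T (c n) = of_nat (n * n) \<odot> c n" for n
    by (simp add: brk_smul_right smul_smul)
  have eig: "\<lbrace>\<iota> h0,c' n\<rbrace> = (- of_nat n) \<odot> c' n" for n
  proof -
    have "(-1) \<odot> \<lbrace>\<iota> h0,c' n\<rbrace> = of_nat n \<odot> c' n"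
      using F.piece_eigen[OF c'(1), of n] unfolding E.\<iota>_smul by (simp add: brk_smul_left)
    then have "(-1) \<odot> (-1) \<odot> \<lbrace>\<iota> h0,c' n\<rbrace> = (-1) \<odot> of_nat n \<odot> c' n" by simp
    then show ?thesis by (simp add: smul_smul smul_one)
  qed
  then have Tc': "?T (c' n) = of_nat (n * n) \<odot> c' n" for n
    by (simp add: brk_smul_right smul_smul)
  have Td: "?T (d n) = of_nat (n * n) \<odot> d n" for n
    by (simp add: d_def brk_add_right smul_add_right Tc Tc')
  \<comment> \<open>The total length of the three sums; its rearrangements have the shape that
    \<open>lsum_pad\<close> expects.\<close>
  let ?M = "m' + (1 + m)"
  have M: "?M = 1 + (m + m')" "?M = m + (m' + 1)" by simp_all
  have "lsum ?M (\<lambda>n. if n < m' then c' n else \<zero>) = a"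
    unfolding c'(2) by (rule lsum_pad) simp
  moreover have "lsum ?M (\<lambda>n. if n < 1 then \<iota> h else \<zero>) = lsum 1 (\<lambda>_. \<iota> h)"
    unfolding M(1) by (rule lsum_pad) simp
  moreover have "lsum ?M (\<lambda>n. if n < m then c n else \<zero>) = b"
    unfolding c(2) M(2) by (rule lsum_pad) simp
  ultimately have "lsum ?M d = a \<oplus> (lsum 1 (\<lambda>_. \<iota> h) \<oplus> b)"
    unfolding d_def by (simp add: lsum_add del: One_nat_def)
  then have "lsum ?M d = a \<oplus> (\<iota> h \<oplus> b)" by simp
  then have mem: "lsum ?M d \<in> J" using x by simp
  have inj: "inj (\<lambda>n. of_nat (n * n) :: 'f)"
    by (rule injI) (metis of_nat_eq_iff power2_eq_iff_nonneg power2_eq_square zero_le)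
  have "lie_subspace L J" using J by (simp add: lie_ideal_def)
  then have "d 0 \<in> J"
    by (rule eigenvector_components[OF _ T T_J _ Td inj mem]) simp_all
  moreover have "c 0 = \<zero>" "c' 0 = \<zero>" using c(1)[of 0] c'(1)[of 0] by (simp_all add: E.piece_def F.piece_def)
  ultimately show ?thesis by (simp add: d_def split: if_splits)
qed

section \<open>Ideals that avoid the Cartan subalgebra\<close>

definition avoids_cartan :: "'a set \<Rightarrow> bool" where
  "avoids_cartan J \<longleftrightarrow> lie_ideal L J \<and> J \<inter> range \<iota> = {\<zero>}"

lemma zero_in_range: "\<zero> \<in> range \<iota>"
  by (metis E.\<iota>_zero rangeI)

lemma avoids_cartan_zero: "avoids_cartan {\<zero>}"
  using zero_in_range
  by (auto simp: avoids_cartan_def lie_ideal_def subspace_trivial)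

text \<open>By \<open>cartan_component\<close> the elements of both ideals have no Cartan part, so
  neither do their sums, and an element of \<open>H\<close> among these must be 0.\<close>

lemma avoids_cartan_sum:
  assumes J1: "avoids_cartan J1" and J2: "avoids_cartan J2"
  shows "avoids_cartan (sum_set L J1 J2)"
proof -
  have id: "lie_ideal L J1" "lie_ideal L J2" using J1 J2 by (simp_all add: avoids_cartan_def)
  then have sub: "lie_subspace L J1" "lie_subspace L J2" by (simp_all add: lie_ideal_def)
  note [simp] = subspace_carr[OF sub(1)] subspace_carr[OF sub(2)]
  have split: "\<exists>a\<in>F.N. \<exists>b\<in>E.N. x = a \<oplus> b" if "avoids_cartan J" "x \<in> J" for J x
  proof -
    have "x \<in> tri" using that carr_tri by (auto simp: avoids_cartan_def lie_ideal_def lie_subspace_def)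
    then obtain a h b where *: "x = a \<oplus> (\<iota> h \<oplus> b)" "a \<in> F.N" "b \<in> E.N"
      by (auto simp: tri_def sum_set_def E.carr_B)
    then have "\<iota> h \<in> J" using cartan_component that by (auto simp: avoids_cartan_def)
    then have "\<iota> h = \<zero>" using that by (auto simp: avoids_cartan_def)
    then show ?thesis using * by auto
  qed
  have "lie_ideal L (sum_set L J1 J2)"
    unfolding lie_ideal_def lie_subspace_def
  proof (intro conjI ballI allI)
    show "\<zero> \<in> sum_set L J1 J2"
      using subspace_zer[OF sub(1)] subspace_zer[OF sub(2)] add_zer[OF zer_closed]
      unfolding sum_set_def by force
  next
    fix x y assume "x \<in> sum_set L J1 J2" "y \<in> sum_set L J1 J2"
    then obtain u v u' v' where "x = u \<oplus> v" "y = u' \<oplus> v'" "u \<in> J1" "u' \<in> J1" "v \<in> J2" "v' \<in> J2"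
      by (auto simp: sum_set_def)
    moreover from this have "x \<oplus> y = (u \<oplus> u') \<oplus> (v \<oplus> v')" by (simp add: add_ac)
    ultimately show "x \<oplus> y \<in> sum_set L J1 J2"
      unfolding sum_set_def using subspace_add sub by blast
  next
    fix c x assume "x \<in> sum_set L J1 J2"
    then obtain u v where "x = u \<oplus> v" "u \<in> J1" "v \<in> J2" by (auto simp: sum_set_def)
    moreover from this have "c \<odot> x = c \<odot> u \<oplus> c \<odot> v" by (simp add: smul_add_right)
    ultimately show "c \<odot> x \<in> sum_set L J1 J2"
      unfolding sum_set_def using subspace_smul sub by blast
  next
    fix z x assume z: "z \<in> carr L" and "x \<in> sum_set L J1 J2"
    then obtain u v where "x = u \<oplus> v" "u \<in> J1" "v \<in> J2" by (auto simp: sum_set_def)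
    moreover from this have "\<lbrace>z,x\<rbrace> = \<lbrace>z,u\<rbrace> \<oplus> \<lbrace>z,v\<rbrace>" using z by (simp add: brk_add_right)
    ultimately show "\<lbrace>z,x\<rbrace> \<in> sum_set L J1 J2"
      unfolding sum_set_def using id z unfolding lie_ideal_def by blast
  qed (auto simp: sum_set_def)
  moreover have "\<iota> h = \<zero>" if h: "\<iota> h \<in> sum_set L J1 J2" for h
  proof -
    obtain u v where uv: "\<iota> h = u \<oplus> v" "u \<in> J1" "v \<in> J2" using h unfolding sum_set_def by blast
    obtain a b where ab: "a \<in> F.N" "b \<in> E.N" "u = a \<oplus> b" using split[OF J1 uv(2)] by blast
    obtain a' b' where ab': "a' \<in> F.N" "b' \<in> E.N" "v = a' \<oplus> b'" using split[OF J2 uv(3)] by blast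
    have "\<zero> = \<iota> h \<oplus> \<iota> (sc (-1) h)" by (simp only: E.\<iota>_smul add_neg E.\<iota>_closed)
    also have "\<dots> = (a \<oplus> a') \<oplus> (\<iota> (sc (-1) h) \<oplus> (b \<oplus> b'))"
      using ab ab' unfolding uv(1) by (simp add: add_ac)
    \<comment> \<open>A vanishing sum of one element from each triangular summand:
      \<open>cartan_component\<close> for the zero ideal shows that its Cartan part is 0.\<close>
    finally have "(a \<oplus> a') \<oplus> (\<iota> (sc (-1) h) \<oplus> (b \<oplus> b')) \<in> {\<zero>}" by simp
    then have "\<iota> (sc (-1) h) \<in> {\<zero>}"
      using avoids_cartan_zero ab ab'
      by (intro cartan_component[of _ "a \<oplus> a'" _ "b \<oplus> b'"]) (simp_all add: avoids_cartan_def)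
    then have "(-1) \<odot> \<iota> h = \<zero>" by (simp only: E.\<iota>_smul singleton_iff)
    then show ?thesis by (simp add: smul_eq_zer)
  qed
  ultimately show ?thesis
    using zero_in_range unfolding avoids_cartan_def
    by (auto simp: lie_ideal_def lie_subspace_def)
qed

text \<open>The union of all these ideals is closed under addition, because two members from
  different ideals both lie in the sum of these ideals. So the union is itself the greatest one, and
  \<open>GREATEST\<close> denotes it.\<close>

lemma avoids_cartan_greatest: "avoids_cartan (GREATEST J. avoids_cartan J)"
proof -
  let ?M = "\<Union>{J. avoids_cartan J}"
  have mem: "x \<in> ?M" if "avoids_cartan J" "x \<in> J" for x J using that by blast
  have "avoids_cartan ?M"
    unfolding avoids_cartan_def[of ?M] lie_ideal_def lie_subspace_def
  proof (intro conjI ballI allI)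
    show "?M \<subseteq> carr L" by (auto simp: avoids_cartan_def lie_ideal_def lie_subspace_def)
    show "\<zero> \<in> ?M" using mem[OF avoids_cartan_zero] by simp
    show "?M \<inter> range \<iota> = {\<zero>}"
      using \<open>\<zero> \<in> ?M\<close> zero_in_range by (auto simp: avoids_cartan_def)
  next
    fix x y assume "x \<in> ?M" "y \<in> ?M"
    then obtain J1 J2 where *: "avoids_cartan J1" "avoids_cartan J2" "x \<in> J1" "y \<in> J2" by blast
    then have "x \<oplus> y \<in> sum_set L J1 J2" by (auto simp: sum_set_def)
    then show "x \<oplus> y \<in> ?M" using mem avoids_cartan_sum * by blast
  next
    fix c x assume "x \<in> ?M"
    then show "c \<odot> x \<in> ?M" by (auto simp: avoids_cartan_def lie_ideal_def intro: subspace_smul)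
  next
    fix x y assume "x \<in> carr L" "y \<in> ?M"
    then show "\<lbrace>x,y\<rbrace> \<in> ?M" by (auto simp: avoids_cartan_def lie_ideal_def)
  qed
  then show ?thesis by (rule GreatestI2_order) auto
qed

lemma quotient_borel_data:
  assumes J: "avoids_cartan J"
  defines "\<pi> \<equiv> \<lambda>x. ideal_rel L J `` {x}"
  shows "borel_data (lie_quotient L (ideal_rel L J)) sc \<alpha> (\<lambda>h. \<pi> (\<iota> h)) (\<lambda>i. \<pi> (e i))"
proof -
  interpret Q: lie_quotient_setup L J
    using J by unfold_locales (simp add: avoids_cartan_def)
  have \<pi>: "\<pi> x = Q.proj x" for x by (simp add: \<pi>_def Q.proj_def)
  show ?thesis unfolding \<pi>
  proof (intro borel_data.intro half_borel.intro half_borel_axioms.intro borel_data_axioms.intro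
      Q.lie_algebra_Q E.cartan.vector_space_axioms E.roots_separate)
    fix h assume "Q.proj (\<iota> h) = zer Q.Q"
    then have "\<iota> h \<in> J" by (simp add: Q.zer_Q Q.proj_zer_iff)
    then have "\<iota> h = \<zero>" using J by (auto simp: avoids_cartan_def)
    then show "h = 0" by (rule E.\<iota>_inj)
  next
    fix i
    show "Q.proj (e i) \<noteq> zer Q.Q"
    proof
      assume "Q.proj (e i) = zer Q.Q"
      then have "e i \<in> J" by (simp add: Q.zer_Q Q.proj_zer_iff)
      \<comment> \<open>Bracketing with \<open>f i\<close> would put a nonzero coroot into the
        ideal.\<close>
      then have "\<lbrace>e i,f i\<rbrace> \<in> J" by (simp add: Q.J_brk_left)
      then have "\<iota> (\<alpha>v i) = \<zero>" using J by (auto simp: e_f avoids_cartan_def)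
      then show False using E.\<iota>_inj coroot_nonzero by blast
    qed
  qed (simp_all add: Q.carr_Q Q.zer_Q Q.add_Q Q.brk_Q Q.smul_Q E.\<iota>_add E.\<iota>_smul E.\<iota>_e)
qed

end

section \<open>Strings of iterated commutators\<close>

definition fscale :: "'f::field \<Rightarrow> ('x \<Rightarrow> 'f) \<Rightarrow> 'x \<Rightarrow> 'f" where
  "fscale c w = (\<lambda>u. c * w u)"

interpretation fscale: vector_space fscale
  by unfold_locales (auto simp: fscale_def fun_eq_iff algebra_simps)

locale sl2_string = vector_space scl
  for scl :: "'f::field \<Rightarrow> 'w::ab_group_add \<Rightarrow> 'w" +
  fixes X Y :: "'w \<Rightarrow> 'w"
  assumes X_linear: "Vector_Spaces.linear scl scl X"
    and Y_linear: "Vector_Spaces.linear scl scl Y"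
begin

interpretation X: Vector_Spaces.linear scl scl X by (rule X_linear)
interpretation Y: Vector_Spaces.linear scl scl Y by (rule Y_linear)

text \<open>\<open>string n\<close> is the iterated commutator (ad X)^n Y of operators.\<close>

primrec string :: "nat \<Rightarrow> 'w \<Rightarrow> 'w" where
  "string 0 w = Y w"
| "string (Suc n) w = X (string n w) - string n (X w)"

lemma string_linear: "Vector_Spaces.linear scl scl (string n)"
proof (induction n)
  case 0
  have "string 0 = Y" by (rule ext) simp
  then show ?case using Y_linear by simp
next
  case (Suc n)
  interpret S: Vector_Spaces.linear scl scl "string n" by (rule Suc)
  show ?case
    by unfold_locales (simp_all add: X.add S.add X.scale S.scale algebra_simps)
qed

text \<open>Each commutator with \<open>X\<close> raises the eigenvalue under \<open>ad H\<close> by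
  2.\<close>

lemma string_cartan:
  assumes H: "Vector_Spaces.linear scl scl H"
    and HX: "\<And>w. H (X w) = X (H w) + scl 2 (X w)"
    and HY: "\<And>w. H (Y w) = Y (H w) + scl a (Y w)"
  shows "H (string n w) = string n (H w) + scl (a + 2 * of_nat n) (string n w)"
proof (induction n arbitrary: w)
  case 0
  then show ?case using HY by simp
next
  case (Suc n)
  interpret H: Vector_Spaces.linear scl scl H by (rule H)
  interpret S: Vector_Spaces.linear scl scl "string n" by (rule string_linear)
  show ?case
    by (simp add: H.diff Suc HX X.add S.add X.scale S.scale X.diff scale_right_diff_distrib
        scale_left_distrib algebra_simps)
qed

text \<open>The sl2 computation: since [Z, X] = -H and [Z, Y] = 0, the commutator with
  \<open>Z\<close> shortens the string by one step. Its factor vanishes at n = -a, which is the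
  origin of the Serre exponent 1 - a.\<close>

lemma string_commutator:
  assumes H: "Vector_Spaces.linear scl scl H" and Z: "Vector_Spaces.linear scl scl Z"
    and HX: "\<And>w. H (X w) = X (H w) + scl 2 (X w)"
    and HY: "\<And>w. H (Y w) = Y (H w) + scl a (Y w)"
    and ZX: "\<And>w. Z (X w) = X (Z w) - H w"
    and ZY: "\<And>w. Z (Y w) = Y (Z w)"
  shows "Z (string (Suc n) w) = string (Suc n) (Z w) - scl (of_nat (Suc n) * (a + of_nat n)) (string n w)"
proof (induction n arbitrary: w)
  case 0
  interpret Z: Vector_Spaces.linear scl scl Z by (rule Z)
  show ?case by (simp add: Z.diff ZX ZY HY Y.diff)
next
  case (Suc n)
  interpret Z: Vector_Spaces.linear scl scl Z by (rule Z)
  interpret S: Vector_Spaces.linear scl scl "string n" by (rule string_linear)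
  interpret SS: Vector_Spaces.linear scl scl "string (Suc n)" by (rule string_linear)
  note st = string_cartan[OF H HX HY]
  have "Z (string (Suc (Suc n)) w) = Z (X (string (Suc n) w)) - Z (string (Suc n) (X w))"
    by (simp only: string.simps(2)[of "Suc n"] Z.diff)
  also have "\<dots> = X (Z (string (Suc n) w)) - H (string (Suc n) w) -
     (string (Suc n) (Z (X w)) - scl (of_nat (Suc n) * (a + of_nat n)) (string n (X w)))"
    by (simp only: ZX Suc)
  also have "\<dots> = X (string (Suc n) (Z w)) - scl (of_nat (Suc n) * (a + of_nat n)) (X (string n w))
     - string (Suc n) (H w) - scl (a + 2 * of_nat (Suc n)) (string (Suc n) w) -
     (string (Suc n) (X (Z w)) - string (Suc n) (H w) - scl (of_nat (Suc n) * (a + of_nat n)) (string n (X w)))"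
    by (simp only: ZX Suc st X.diff X.scale SS.diff) (simp add: algebra_simps)
  also have "\<dots> = string (Suc (Suc n)) (Z w) - scl (of_nat (Suc n) * (a + of_nat n)) (string (Suc n) w)
     - scl (a + 2 * of_nat (Suc n)) (string (Suc n) w)"
    by (simp only: string.simps(2)) (simp add: scale_right_diff_distrib algebra_simps)
  also have "\<dots> = string (Suc (Suc n)) (Z w) -
     scl (of_nat (Suc n) * (a + of_nat n) + (a + 2 * of_nat (Suc n))) (string (Suc n) w)"
    by (simp only: scale_left_distrib) (simp add: algebra_simps)
  \<comment> \<open>The coefficient grows in each step by the eigenvalue from
    \<open>string_cartan\<close>; this is its closed form.\<close>
  also have "of_nat (Suc n) * (a + of_nat n) + (a + 2 * of_nat (Suc n)) = of_nat (Suc (Suc n)) * (a + of_nat (Suc n))"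
    by (simp add: algebra_simps)
  finally show ?case .
qed

lemma string_commutes:
  assumes Z: "Vector_Spaces.linear scl scl Z"
    and ZX: "\<And>w. Z (X w) = X (Z w)" and ZY: "\<And>w. Z (Y w) = Y (Z w)"
  shows "Z (string n w) = string n (Z w)"
proof (induction n arbitrary: w)
  case (Suc n)
  interpret Z: Vector_Spaces.linear scl scl Z by (rule Z)
  show ?case by (simp add: Suc Z.diff ZX)
qed (simp add: ZY)

text \<open>Here \<open>Z\<close> is opposite to \<open>Y\<close>. Its commutator with the string of
  length 1 is \<open>b\<close> times \<open>X\<close>, and this commutes with \<open>X\<close>, so
  all longer strings commute with \<open>Z\<close>.\<close>

lemma string_commutes_dual:
  assumes H: "Vector_Spaces.linear scl scl H" and Z: "Vector_Spaces.linear scl scl Z"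
    and HX: "\<And>w. H (X w) = X (H w) + scl b (X w)"
    and ZX: "\<And>w. Z (X w) = X (Z w)"
    and ZY: "\<And>w. Z (Y w) = Y (Z w) - H w"
    and n: "n > 0" "n = 1 \<Longrightarrow> b = 0"
  shows "Z (string n w) = string n (Z w)"
proof -
  interpret Z: Vector_Spaces.linear scl scl Z by (rule Z)
  have 1: "Z (string 1 w) = string 1 (Z w) + scl b (X w)" for w
    by (simp add: Z.diff ZX ZY X.diff HX)
  have 2: "Z (string (Suc (Suc n)) w) = string (Suc (Suc n)) (Z w)" for n w
  proof (induction n arbitrary: w)
    case 0
    have "Z (string (Suc (Suc 0)) w) = X (Z (string 1 w)) - Z (string 1 (X w))"
      by (simp only: string.simps(2)[of "Suc 0"] Z.diff ZX One_nat_def)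
    then show ?case by (simp only: 1 ZX) (simp add: X.add X.scale)
  next
    case (Suc n)
    have "Z (string (Suc (Suc (Suc n))) w) = X (Z (string (Suc (Suc n)) w)) - Z (string (Suc (Suc n)) (X w))"
      by (simp only: string.simps(2)[of "Suc (Suc n)"] Z.diff ZX)
    then show ?case by (simp only: Suc ZX) simp
  qed
  show ?thesis
  proof (cases "n = 1")
    case True
    then show ?thesis using 1 n(2) by simp
  next
    case False
    then have "n = Suc (Suc (n - 2))" using n(1) by simp
    then show ?thesis using 2[of "n - 2" w] by simp
  qed
qed

end

section \<open>The action on functions on words\<close>

locale weight_model = realization sc A \<alpha> \<alpha>v
  for sc :: "'f::field_char_0 \<Rightarrow> 'h::ab_group_add \<Rightarrow> 'h"
    and A :: "int^'i^'i::finite" and \<alpha> :: "'i \<Rightarrow> 'h \<Rightarrow> 'f" and \<alpha>v :: "'i \<Rightarrow> 'h" +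
  fixes \<omega> :: "'h \<Rightarrow> 'f"
  assumes \<omega>_linear: "Vector_Spaces.linear sc (*) \<omega>"
    and cartan_matrix: "gen_cartan_matrix A"
begin

text \<open>The induction methods eta-expand terms of function type; these rules would then expose the
  pointwise definitions of the operations.\<close>

lemmas pointwise = plus_fun_apply zero_fun_apply minus_apply uminus_apply

declare pointwise [simp del]

section \<open>The operators of the representation\<close>

definition wt :: "'i list \<Rightarrow> 'h \<Rightarrow> 'f" where
  "wt u h = \<omega> h - (\<Sum>j\<leftarrow>u. \<alpha> j h)"

lemma wt_simps [simp]: "wt [] h = \<omega> h" "wt (j # u) h = wt u h - \<alpha> j h"
  by (simp_all add: wt_def)

lemma root_add: "\<alpha> i (h + h') = \<alpha> i h + \<alpha> i h'" and root_scale: "\<alpha> i (sc c h) = c * \<alpha> i h"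
  using root_linear[of i] by (simp_all add: linear_iff_module_hom module_hom.add module_hom.scale)

lemma wt_add: "wt u (h + h') = wt u h + wt u h'" and wt_scale: "wt u (sc c h) = c * wt u h"
  using \<omega>_linear
  by (induction u)
   (simp_all add: linear_iff_module_hom module_hom.add module_hom.scale root_add root_scale algebra_simps)

definition Hop :: "'h \<Rightarrow> ('i list \<Rightarrow> 'f) \<Rightarrow> 'i list \<Rightarrow> 'f" where
  "Hop h w u = wt u h * w u"

text \<open>The transpose of left multiplication by the letter \<open>i\<close> in the tensor
  algebra.\<close>

definition Eop :: "'i \<Rightarrow> ('i list \<Rightarrow> 'f) \<Rightarrow> 'i list \<Rightarrow> 'f" where
  "Eop i w u = w (i # u)"

text \<open>The value of \<open>Fop i w\<close> at \<open>j # u\<close> is that of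
  \<open>Eop j (Fop i w)\<close> at \<open>u\<close>. The required commutator of
  \<open>Eop j\<close> and \<open>Fop i\<close> therefore forces this recursion, once the value at
  the empty word is set to 0.\<close>

primrec Fval :: "'i \<Rightarrow> 'i list \<Rightarrow> ('i list \<Rightarrow> 'f) \<Rightarrow> 'f" where
  "Fval i [] w = 0"
| "Fval i (j # u) w = Fval i u (Eop j w) + (if i = j then Hop (\<alpha>v i) w u else 0)"

definition Fop :: "'i \<Rightarrow> ('i list \<Rightarrow> 'f) \<Rightarrow> 'i list \<Rightarrow> 'f" where
  "Fop i w u = Fval i u w"

abbreviation lin where "lin \<equiv> Vector_Spaces.linear fscale fscale"

lemma linI:
  assumes "\<And>v w. T (v + w) = T v + T w" "\<And>c w. T (fscale c w) = fscale c (T w)"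
  shows "lin T"
  using assms by unfold_locales

lemma Hop_lin: "lin (Hop h)"
  by (rule linI) (auto simp: Hop_def fscale_def fun_eq_iff pointwise algebra_simps)

lemma Eop_lin: "lin (Eop i)"
  by (rule linI) (auto simp: Eop_def fscale_def fun_eq_iff pointwise)

lemma Hop_pointwise:
  "Hop h (v + w) u = Hop h v u + Hop h w u" "Hop h (fscale c w) u = c * Hop h w u"
  by (simp_all add: Hop_def fscale_def pointwise distrib_left)

lemma Fval_add: "Fval i u (v + w) = Fval i u v + Fval i u w"
proof (induction u arbitrary: v w)
  case (Cons j u)
  interpret E: Vector_Spaces.linear fscale fscale "Eop j" by (rule Eop_lin)
  show ?case by (simp add: Cons E.add Hop_pointwise add_ac)
qed simp

lemma Fval_scale: "Fval i u (fscale c w) = c * Fval i u w"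
proof (induction u arbitrary: w)
  case (Cons j u)
  interpret E: Vector_Spaces.linear fscale fscale "Eop j" by (rule Eop_lin)
  show ?case by (simp add: Cons E.scale Hop_pointwise distrib_left)
qed simp

lemma Fop_lin: "lin (Fop i)"
  by (rule linI) (auto simp: Fop_def fun_eq_iff pointwise Fval_add Fval_scale fscale_def[of c "Fop i w" for c w])

lemma Eop_Fop: "Eop i (Fop j w) = Fop j (Eop i w) + (if i = j then Hop (\<alpha>v i) w else 0)"
  by (auto simp: fun_eq_iff pointwise Eop_def[of i "Fop j w"] Fop_def)

lemma Hop_Eop: "Hop h (Eop i w) = Eop i (Hop h w) + fscale (\<alpha> i h) (Eop i w)"
  by (auto simp: fun_eq_iff pointwise Hop_def Eop_def fscale_def algebra_simps)

lemma Hop_Hop: "Hop h (Hop h' w) = Hop h' (Hop h w)"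
  by (auto simp: fun_eq_iff pointwise Hop_def)

lemma Hop_Fop: "Hop h (Fop i w) = Fop i (Hop h w) - fscale (\<alpha> i h) (Fop i w)"
proof -
  \<comment> \<open>The induction on the word keeps \<open>w\<close> arbitrary, since the recursion
    replaces it by \<open>Eop j w\<close>.\<close>
  have "wt u h * Fval i u w = Fval i u (Hop h w) - \<alpha> i h * Fval i u w" for u
  proof (induction u arbitrary: w)
    case (Cons j u)
    have "Hop h (Eop j w) = Eop j (Hop h w) + fscale (\<alpha> j h) (Eop j w)" by (rule Hop_Eop)
    then have "Fval i u (Hop h (Eop j w)) = Fval i u (Eop j (Hop h w)) + \<alpha> j h * Fval i u (Eop j w)"
      by (simp add: Fval_add Fval_scale)
    moreover have "Hop (\<alpha>v i) (Hop h w) u = wt u h * Hop (\<alpha>v i) w u"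
      by (simp add: Hop_def)
    ultimately show ?case using Cons[of "Eop j w"]
      by (cases "i = j") (simp_all add: distrib_left left_diff_distrib)
  qed simp
  then show ?thesis by (auto simp: fun_eq_iff pointwise Hop_def[of h "Fop i w"] Fop_def fscale_def)
qed

lemma Hop_add: "Hop (h + h') w = Hop h w + Hop h' w"
  by (auto simp: fun_eq_iff pointwise Hop_def wt_add algebra_simps)

lemma Hop_scale: "Hop (sc c h) w = fscale c (Hop h w)"
  by (auto simp: fun_eq_iff pointwise Hop_def wt_scale fscale_def)

primrec op_of :: "('f, ('h, 'i) km_gen) lie_term \<Rightarrow> ('i list \<Rightarrow> 'f) \<Rightarrow> 'i list \<Rightarrow> 'f" where
  "op_of (Gen g) = (case g of GH h \<Rightarrow> Hop h | GE i \<Rightarrow> Eop i | GF i \<Rightarrow> Fop i)"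
| "op_of TZero = (\<lambda>w. 0)"
| "op_of (TAdd s t) = (\<lambda>w. op_of s w + op_of t w)"
| "op_of (TSmul c t) = (\<lambda>w. fscale c (op_of t w))"
| "op_of (TBrk s t) = (\<lambda>w. op_of s (op_of t w) - op_of t (op_of s w))"

lemma op_of_lin: "lin (op_of t)"
proof (induction t)
  case (Gen g)
  then show ?case using Hop_lin Eop_lin Fop_lin by (cases g) auto
next
  case TZero
  show ?case by (rule linI) simp_all
next
  case (TAdd s t)
  interpret s: Vector_Spaces.linear fscale fscale "op_of s" by fact
  interpret t: Vector_Spaces.linear fscale fscale "op_of t" by fact
  show ?case by (rule linI) (auto simp: s.add t.add s.scale t.scale fscale.scale_right_distrib)
next
  case (TSmul c t)
  interpret t: Vector_Spaces.linear fscale fscale "op_of t" by fact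
  show ?case by (rule linI) (auto simp: t.add t.scale fscale.scale_right_distrib mult.commute)
next
  case (TBrk s t)
  interpret s: Vector_Spaces.linear fscale fscale "op_of s" by fact
  interpret t: Vector_Spaces.linear fscale fscale "op_of t" by fact
  show ?case by (rule linI)
    (auto simp: s.add t.add s.scale t.scale fscale.scale_right_diff_distrib algebra_simps)
qed

section \<open>The submodule generated by the indicator of the empty word\<close>

definition vac :: "'i list \<Rightarrow> 'f" where "vac u = (if u = [] then 1 else 0)"

text \<open>Closure under the lowering operators suffices to generate the submodule; stability under
  the others follows from the commutation rules. It is here that the positive Serre elements act by
  0.\<close>

inductive_set cyclic :: "('i list \<Rightarrow> 'f) set" where
  vac: "vac \<in> cyclic"
| zero: "0 \<in> cyclic"
| add: "v \<in> cyclic \<Longrightarrow> w \<in> cyclic \<Longrightarrow> v + w \<in> cyclic"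
| scale: "w \<in> cyclic \<Longrightarrow> fscale c w \<in> cyclic"
| lower: "w \<in> cyclic \<Longrightarrow> Fop i w \<in> cyclic"

lemma cyclic_diff: "v \<in> cyclic \<Longrightarrow> w \<in> cyclic \<Longrightarrow> v - w \<in> cyclic"
  using cyclic.add[OF _ cyclic.scale[of w "-1"]] by fastforce

lemma Eop_vac: "Eop i vac = 0"
  by (auto simp: fun_eq_iff pointwise Eop_def vac_def)

lemma cyclic_Hop: "w \<in> cyclic \<Longrightarrow> Hop h w \<in> cyclic"
proof (induction rule: cyclic.induct)
  case vac
  have "Hop h vac = fscale (\<omega> h) vac" by (auto simp: fun_eq_iff pointwise Hop_def vac_def fscale_def)
  then show ?case by (simp add: cyclic.intros)
next
  case (lower w i)
  then show ?case unfolding Hop_Fop by (blast intro: cyclic.intros cyclic_diff)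
qed (simp_all add: cyclic.intros module_hom.add[OF Hop_lin[THEN linear_iff_module_hom[THEN iffD1]]]
       module_hom.zero[OF Hop_lin[THEN linear_iff_module_hom[THEN iffD1]]]
       module_hom.scale[OF Hop_lin[THEN linear_iff_module_hom[THEN iffD1]]])

text \<open>Moving \<open>Eop\<close> past \<open>Fop\<close> costs a Cartan operator, under which
  the submodule is already stable; in the end \<open>Eop\<close> kills \<open>vac\<close>.\<close>

lemma cyclic_Eop: "w \<in> cyclic \<Longrightarrow> Eop j w \<in> cyclic"
proof (induction rule: cyclic.induct)
  case vac
  then show ?case unfolding Eop_vac by (rule cyclic.zero)
next
  case (lower w i)
  then show ?case unfolding Eop_Fop by (auto intro: cyclic.intros cyclic_Hop)
qed (simp_all add: cyclic.intros module_hom.add[OF Eop_lin[THEN linear_iff_module_hom[THEN iffD1]]]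
       module_hom.zero[OF Eop_lin[THEN linear_iff_module_hom[THEN iffD1]]]
       module_hom.scale[OF Eop_lin[THEN linear_iff_module_hom[THEN iffD1]]])

lemma cyclic_op_of: "w \<in> cyclic \<Longrightarrow> op_of t w \<in> cyclic"
proof (induction t arbitrary: w)
  case (Gen g)
  then show ?case by (cases g) (auto simp: cyclic_Hop cyclic_Eop cyclic.lower)
qed (auto intro: cyclic.intros cyclic_diff)

section \<open>The Serre relations\<close>

lemma neg_Hop_lin: "lin (\<lambda>w. - Hop h w)"
  by (rule linI) (auto simp: Hop_def fscale_def fun_eq_iff pointwise algebra_simps)

lemma Fop_neg: "Fop i (- w) = - Fop i w"
proof -
  interpret F: Vector_Spaces.linear fscale fscale "Fop i" by (rule Fop_lin)
  show ?thesis by (rule F.neg)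
qed

definition serre_exp :: "'i \<Rightarrow> 'i \<Rightarrow> nat" where "serre_exp i j = nat (1 - A $ i $ j)"

text \<open>\<open>m\<close> is the negative of the matrix entry, the value at which the factor in
  \<open>string_commutator\<close> vanishes.\<close>

lemma serre_exp_eq:
  assumes "i \<noteq> j"
  obtains m where "serre_exp i j = Suc m" "of_int (A $ i $ j) + of_nat m = (0::'f)"
proof
  have "A $ i $ j \<le> 0" using cartan_matrix assms by (auto simp: gen_cartan_matrix_def)
  then show "serre_exp i j = Suc (nat (- A $ i $ j))"
    "of_int (A $ i $ j) + of_nat (nat (- A $ i $ j)) = (0::'f)"
    by (simp_all add: serre_exp_def)
qed

text \<open>Exponent 1 is the exceptional case of \<open>string_commutes_dual\<close>; the symmetric
  zero pattern of the matrix then gives \<open>b\<close> = 0.\<close>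

lemma serre_exp_1: "i \<noteq> j \<Longrightarrow> serre_exp i j = 1 \<Longrightarrow> A $ j $ i = 0"
proof -
  assume "i \<noteq> j" "serre_exp i j = 1"
  then have "nat (1 - A $ i $ j) = 1" by (simp add: serre_exp_def)
  then have "A $ i $ j = 0" by arith
  then show ?thesis using cartan_matrix by (simp add: gen_cartan_matrix_def)
qed

lemma diag: "A $ i $ i = 2"
  using cartan_matrix by (auto simp: gen_cartan_matrix_def)

text \<open>For \<open>k\<close> = \<open>i\<close> the sl2 factor vanishes at the Serre exponent;
  for \<open>k\<close> = \<open>j\<close> the dual string lemma applies; any other
  \<open>Eop k\<close> commutes with both factors. The Cartan operator is the negative of
  \<open>Hop\<close>, because raising and lowering exchange roles.\<close>

lemma serre_F_commutes:
  assumes ij: "i \<noteq> j"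
  shows "Eop k (sl2_string.string (Fop i) (Fop j) (serre_exp i j) w) =
    sl2_string.string (Fop i) (Fop j) (serre_exp i j) (Eop k w)"
proof -
  interpret F: sl2_string fscale "Fop i" "Fop j" by (intro sl2_string.intro sl2_string_axioms.intro Fop_lin fscale.vector_space_axioms)
  obtain m where m: "serre_exp i j = Suc m" "of_int (A $ i $ j) + of_nat m = (0::'f)"
    using serre_exp_eq[OF ij] .
  consider "k = i" | "k = j" | "k \<noteq> i" "k \<noteq> j" by blast
  then show ?thesis
  proof cases
    case 1
    have "Eop k (F.string (Suc m) w) = F.string (Suc m) (Eop k w) -
        fscale (of_nat (Suc m) * (of_int (A $ i $ j) + of_nat m)) (F.string m w)"
      by (rule F.string_commutator[OF neg_Hop_lin[of "\<alpha>v i"] Eop_lin])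
        (use ij 1 in \<open>simp_all add: Hop_Fop Eop_Fop Fop_neg root_coroot diag\<close>)
    then show ?thesis using m by simp
  next
    case 2
    show ?thesis
      by (rule F.string_commutes_dual[OF neg_Hop_lin[of "\<alpha>v j"] Eop_lin, where b = "of_int (A $ j $ i)"])
        (use ij 2 m(1) in \<open>simp_all add: Hop_Fop Eop_Fop Fop_neg root_coroot serre_exp_1\<close>)
  next
    case 3
    show ?thesis
      by (rule F.string_commutes[OF Eop_lin]) (use ij 3 in \<open>simp_all add: Eop_Fop\<close>)
  qed
qed

lemma serre_E_commutes:
  assumes ij: "i \<noteq> j"
  shows "Fop k (sl2_string.string (Eop i) (Eop j) (serre_exp i j) w) =
    sl2_string.string (Eop i) (Eop j) (serre_exp i j) (Fop k w)"
proof -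
  interpret E: sl2_string fscale "Eop i" "Eop j" by (intro sl2_string.intro sl2_string_axioms.intro Eop_lin fscale.vector_space_axioms)
  obtain m where m: "serre_exp i j = Suc m" "of_int (A $ i $ j) + of_nat m = (0::'f)"
    using serre_exp_eq[OF ij] .
  consider "k = i" | "k = j" | "k \<noteq> i" "k \<noteq> j" by blast
  then show ?thesis
  proof cases
    case 1
    have "Fop k (E.string (Suc m) w) = E.string (Suc m) (Fop k w) -
        fscale (of_nat (Suc m) * (of_int (A $ i $ j) + of_nat m)) (E.string m w)"
      by (rule E.string_commutator[OF Hop_lin[of "\<alpha>v i"] Fop_lin])
        (use ij 1 in \<open>simp_all add: Hop_Eop Eop_Fop root_coroot diag\<close>)
    then show ?thesis using m by simp
  next
    case 2
    show ?thesis
      by (rule E.string_commutes_dual[OF Hop_lin[of "\<alpha>v j"] Fop_lin, where b = "of_int (A $ j $ i)"])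
        (use ij 2 m(1) in \<open>simp_all add: Hop_Eop Eop_Fop root_coroot serre_exp_1\<close>)
  next
    case 3
    show ?thesis
      by (rule E.string_commutes[OF Fop_lin]) (use ij 3 in \<open>simp_all add: Eop_Fop\<close>)
  qed
qed

text \<open>The \<open>E\<close> operators are shifts, so an operator commuting with all of them is determined by the
  values of its images at the empty word; every operator built from the \<open>F\<close>s vanishes there.\<close>

lemma serre_F_zero:
  assumes ij: "i \<noteq> j"
  shows "sl2_string.string (Fop i) (Fop j) (serre_exp i j) w = 0"
proof -
  interpret F: sl2_string fscale "Fop i" "Fop j" by (intro sl2_string.intro sl2_string_axioms.intro Fop_lin fscale.vector_space_axioms)
  have nil: "F.string n w [] = 0" for n w
    by (induction n arbitrary: w) (simp_all add: Fop_def pointwise)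
  have "F.string (serre_exp i j) w u = 0" for u
  proof (induction u arbitrary: w)
    case (Cons k u)
    have "F.string (serre_exp i j) w (k # u) = Eop k (F.string (serre_exp i j) w) u"
      by (simp add: Eop_def)
    then show ?case using Cons by (simp add: serre_F_commutes[OF ij])
  qed (rule nil)
  then show ?thesis by (simp add: fun_eq_iff pointwise)
qed

text \<open>Each \<open>Eop\<close> kills \<open>vac\<close>, hence so does the Serre element, and
  as it commutes with the lowering operators it kills everything they generate from
  \<open>vac\<close>.\<close>

lemma serre_E_zero:
  assumes ij: "i \<noteq> j" and w: "w \<in> cyclic"
  shows "sl2_string.string (Eop i) (Eop j) (serre_exp i j) w = 0"
proof -
  interpret E: sl2_string fscale "Eop i" "Eop j" by (intro sl2_string.intro sl2_string_axioms.intro Eop_lin fscale.vector_space_axioms)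
  interpret S: Vector_Spaces.linear fscale fscale "E.string (serre_exp i j)" by (rule E.string_linear)
  have string_vac: "E.string n vac = 0" for n
  proof (induction n)
    case (Suc n)
    interpret X: Vector_Spaces.linear fscale fscale "Eop i" by (rule Eop_lin)
    interpret S: Vector_Spaces.linear fscale fscale "E.string n" by (rule E.string_linear)
    show ?case by (simp add: Suc Eop_vac X.zero S.zero)
  qed (simp add: Eop_vac)
  from w show ?thesis
  proof (induction rule: cyclic.induct)
    case (lower w k)
    interpret F: Vector_Spaces.linear fscale fscale "Fop k" by (rule Fop_lin)
    show ?case using serre_E_commutes[OF ij, of k w] lower by (simp add: F.zero)
  qed (simp_all add: string_vac S.zero S.add S.scale)
qed

lemma op_of_serre_E: "op_of ((TBrk (TE i) ^^ n) (TE j)) = sl2_string.string (Eop i) (Eop j) n"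
proof -
  interpret E: sl2_string fscale "Eop i" "Eop j" by (intro sl2_string.intro sl2_string_axioms.intro Eop_lin fscale.vector_space_axioms)
  show ?thesis
  proof (induction n)
    case (Suc n)
    show ?case by (rule ext) (simp add: Suc)
  qed (rule ext, simp)
qed

lemma op_of_serre_F: "op_of ((TBrk (TF i) ^^ n) (TF j)) = sl2_string.string (Fop i) (Fop j) n"
proof -
  interpret F: sl2_string fscale "Fop i" "Fop j" by (intro sl2_string.intro sl2_string_axioms.intro Fop_lin fscale.vector_space_axioms)
  show ?thesis
  proof (induction n)
    case (Suc n)
    show ?case by (rule ext) (simp add: Suc)
  qed (rule ext, simp)
qed

lemma op_of_rel:
  assumes "(s, t) \<in> km_rels sc A \<alpha> \<alpha>v" "w \<in> cyclic"
  shows "op_of s w = op_of t w"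
  using assms(1)
proof cases
  case (EF i j)
  then show ?thesis by (auto simp: Eop_Fop)
next
  case (serre_E i j)
  then show ?thesis using serre_E_zero[OF _ assms(2)]
    by (simp add: op_of_serre_E serre_exp_def del: funpow.simps)
next
  case (serre_F i j)
  then show ?thesis using serre_F_zero
    by (simp add: op_of_serre_F serre_exp_def del: funpow.simps)
qed (auto simp: Hop_add Hop_scale Hop_Hop Hop_Eop Hop_Fop fscale.scale_minus_left)

lemma op_of_cong:
  assumes "(s, t) \<in> lie_cong (km_rels sc A \<alpha> \<alpha>v)"
  shows "w \<in> cyclic \<Longrightarrow> op_of s w = op_of t w"
  using assms
proof (induction arbitrary: w rule: lie_cong.induct)
  case (rel s t)
  then show ?case using op_of_rel by blast
next
  \<comment> \<open>The outer operators are compared at vectors such as \<open>op_of t w\<close>,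
    which lie in the submodule because it is stable.\<close>
  case (cong_brk s s' t t')
  then show ?case by (simp add: cyclic_op_of)
next
  case (brk_add_right s t u)
  interpret s: Vector_Spaces.linear fscale fscale "op_of s" by (rule op_of_lin)
  show ?case by (simp add: s.add algebra_simps)
next
  case (brk_add_left s t u)
  interpret u: Vector_Spaces.linear fscale fscale "op_of u" by (rule op_of_lin)
  show ?case by (simp add: u.add algebra_simps)
next
  case (brk_smul_left c s t)
  interpret t: Vector_Spaces.linear fscale fscale "op_of t" by (rule op_of_lin)
  show ?case by (simp add: t.scale fscale.scale_right_diff_distrib)
next
  case (brk_smul_right s c t)
  interpret s: Vector_Spaces.linear fscale fscale "op_of s" by (rule op_of_lin)
  show ?case by (simp add: s.scale fscale.scale_right_diff_distrib)
next
  case (jacobi s t u)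
  interpret s: Vector_Spaces.linear fscale fscale "op_of s" by (rule op_of_lin)
  interpret t: Vector_Spaces.linear fscale fscale "op_of t" by (rule op_of_lin)
  interpret u: Vector_Spaces.linear fscale fscale "op_of u" by (rule op_of_lin)
  show ?case by (simp add: s.diff t.diff u.diff)
qed (auto simp: fscale.scale_right_distrib fscale.scale_left_distrib algebra_simps)

text \<open>The action of \<open>h\<close> on \<open>vac\<close>, evaluated at the empty word, is
  \<omega> h.\<close>

lemma weight_vanishes:
  assumes "(TH h, TZero) \<in> lie_cong (km_rels sc A \<alpha> \<alpha>v)"
  shows "\<omega> h = 0"
  using fun_cong[OF op_of_cong[OF assms cyclic.vac], of "[]"] by (simp add: Hop_def vac_def pointwise)

end

section \<open>The Cartan subalgebra embeds in the contragredient Lie algebra\<close>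

context realization
begin

lemma TH_injective:
  assumes "gen_cartan_matrix A" "(TH h, TZero) \<in> lie_cong (km_rels sc A \<alpha> \<alpha>v)"
  shows "h = 0"
proof (rule ccontr)
  assume h: "h \<noteq> 0"
  interpret F: vector_space "(*) :: 'f \<Rightarrow> 'f \<Rightarrow> 'f" by unfold_locales (auto simp: algebra_simps)
  interpret P: vector_space_pair sc "(*) :: 'f \<Rightarrow> 'f \<Rightarrow> 'f" by unfold_locales
  have "independent {h}" using h by simp
  \<comment> \<open>A linear form that does not vanish at \<open>h\<close> serves as the weight
    \<omega>.\<close>
  then obtain g where g: "Vector_Spaces.linear sc (*) g" "g h = 1"
    using P.linear_independent_extend[of "{h}" "\<lambda>_. 1"] by auto
  interpret weight_model sc A \<alpha> \<alpha>v g
    by (intro weight_model.intro weight_model_axioms.intro realization_axioms g(1) assms(1))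
  show False using weight_vanishes[OF assms(2)] g(2) by simp
qed

lemma dual_vectors:
  assumes "finite S"
  shows "\<exists>d. \<forall>i\<in>S. \<forall>j\<in>S. \<alpha> i (d j) = (if i = j then 1 else 0)"
  using assms
proof (induction S rule: finite_induct)
  case (insert k S)
  have add: "\<alpha> i (h + h') = \<alpha> i h + \<alpha> i h'" and scale: "\<alpha> i (sc c h) = c * \<alpha> i h"
    and diff: "\<alpha> i (h - h') = \<alpha> i h - \<alpha> i h'"
    and sum: "\<alpha> i (\<Sum>j\<in>S. f j) = (\<Sum>j\<in>S. \<alpha> i (f j))" for i h h' c S and f :: "'i \<Rightarrow> 'h"
    using root_linear[of i]
    by (simp_all add: linear_iff_module_hom module_hom.add module_hom.scale module_hom.diff module_hom.sum)
  obtain d where d: "\<And>i j. i \<in> S \<Longrightarrow> j \<in> S \<Longrightarrow> \<alpha> i (d j) = (if i = j then 1 else 0)"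
    using insert by metis
  \<comment> \<open>Coefficients of the form \<alpha> k minus the sum over \<open>S\<close> of
    \<alpha> k (d i) times \<alpha> i. That of \<alpha> k is 1, so by independence the form is
    nonzero at some \<open>h\<close>.\<close>
  let ?c = "\<lambda>i. if i = k then 1 else if i \<in> S then - \<alpha> k (d i) else 0"
  have "\<not> (\<forall>h. (\<Sum>i\<in>UNIV. ?c i * \<alpha> i h) = 0)"
    using roots_independent[of ?c k] by force
  then obtain h where "(\<Sum>i\<in>UNIV. ?c i * \<alpha> i h) \<noteq> 0" by blast
  also have "(\<Sum>i\<in>UNIV. ?c i * \<alpha> i h) = (\<Sum>i\<in>insert k S. ?c i * \<alpha> i h)"
    by (rule sum.mono_neutral_right) auto
  also have "\<dots> = \<alpha> k h - (\<Sum>i\<in>S. \<alpha> k (d i) * \<alpha> i h)"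
    using insert(1,2) by (simp add: sum_negf[symmetric]) (rule sum.cong, auto)
  finally have ne: "\<alpha> k h - (\<Sum>i\<in>S. \<alpha> k (d i) * \<alpha> i h) \<noteq> 0" .
  \<comment> \<open>Correcting \<open>h\<close> by the old dual vectors makes the roots in
    \<open>S\<close> vanish, while \<alpha> k takes the nonzero value just found.\<close>
  define g where "g = h - (\<Sum>i\<in>S. sc (\<alpha> i h) (d i))"
  have gk: "\<alpha> k g \<noteq> 0"
    using ne by (simp add: g_def diff sum scale mult.commute)
  have gS: "\<alpha> i g = 0" if "i \<in> S" for i
  proof -
    have "(\<Sum>j\<in>S. \<alpha> j h * \<alpha> i (d j)) = (\<Sum>j\<in>S. if j = i then \<alpha> j h else 0)"
      using that by (intro sum.cong) (auto simp: d)
    also have "\<dots> = \<alpha> i h" using that insert(1) by simp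
    finally show ?thesis by (simp add: g_def diff sum scale)
  qed
  \<comment> \<open>The rescaled \<open>g\<close> is the new dual vector, and multiples of it are
    subtracted from the old ones so that \<alpha> k vanishes there.\<close>
  let ?d = "\<lambda>j. if j = k then sc (1 / \<alpha> k g) g else d j - sc (\<alpha> k (d j) / \<alpha> k g) g"
  have "\<forall>i\<in>insert k S. \<forall>j\<in>insert k S. \<alpha> i (?d j) = (if i = j then 1 else 0)"
    using insert(2) gk by (auto simp: scale diff gS d)
  then show ?case by (rule exI[of _ ?d])
qed simp

lemma roots_surjective: "\<exists>h. \<forall>i. \<alpha> i h = k i"
proof -
  obtain d where d: "\<And>i j. \<alpha> i (d j) = (if i = j then 1 else 0)"
    using dual_vectors[of UNIV] by auto
  have "\<alpha> i (\<Sum>j\<in>UNIV. sc (k j) (d j)) = k i" for i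
  proof -
    have "\<alpha> i (\<Sum>j\<in>UNIV. sc (k j) (d j)) = (\<Sum>j\<in>UNIV. k j * \<alpha> i (d j))"
      using root_linear[of i] by (simp add: linear_iff_module_hom module_hom.scale module_hom.sum)
    also have "\<dots> = (\<Sum>j\<in>UNIV. if j = i then k j else 0)"
      by (intro sum.cong) (auto simp: d)
    finally show ?thesis by simp
  qed
  then show ?thesis by blast
qed

end

context realization
begin

abbreviation "R \<equiv> km_rels sc A \<alpha> \<alpha>v"
abbreviation "H_class \<equiv> contra_H sc A \<alpha> \<alpha>v"
abbreviation "E_class \<equiv> contra_E sc A \<alpha> \<alpha>v"
abbreviation "F_class \<equiv> \<lambda>i. lie_class R (TF i)"

lemma class_eqI: "(s, t) \<in> R \<Longrightarrow> lie_class R s = lie_class R t"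
  by (simp add: lie_class_eq_iff lie_cong.rel)

lemma coroot_nonzero: "\<alpha>v i \<noteq> 0"
proof
  assume "\<alpha>v i = 0"
  then have "(\<Sum>j\<in>UNIV. sc (if j = i then 1 else 0) (\<alpha>v j)) = 0"
    by (intro sum.neutral) auto
  from coroots_independent[OF this, of i] show False by simp
qed

lemma chevalley_contragredient:
  assumes A: "gen_cartan_matrix A"
  shows "chevalley (contragredient sc A \<alpha> \<alpha>v) sc \<alpha> H_class E_class F_class \<alpha>v"
proof -
  note defs = contragredient_def contra_H_def contra_E_def
  interpret L: lie_algebra "contragredient sc A \<alpha> \<alpha>v"
    unfolding contragredient_def by (rule lie_algebra_presented)
  have sep: "\<exists>h. \<forall>i. \<alpha> i h = k i" "\<exists>h. \<forall>i. - \<alpha> i h = k i" for k :: "'i \<Rightarrow> 'f"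
    using roots_surjective[of k] roots_surjective[of "\<lambda>i. - k i"] by (blast, metis minus_minus)
  have E: "half_borel (contragredient sc A \<alpha> \<alpha>v) sc \<alpha> H_class E_class"
    by (intro half_borel.intro half_borel_axioms.intro L.lie_algebra_axioms sep)
      (simp_all add: defs lie_presented_ops class_eqI km_rels.intros)
  have F: "half_borel (contragredient sc A \<alpha> \<alpha>v) sc (\<lambda>i h. - \<alpha> i h) H_class F_class"
    by (intro half_borel.intro half_borel_axioms.intro L.lie_algebra_axioms sep)
      (simp_all add: defs lie_presented_ops class_eqI km_rels.intros)
  have e_f: "brk (contragredient sc A \<alpha> \<alpha>v) (E_class i) (F_class j) =
      (if i = j then H_class (\<alpha>v i) else zer (contragredient sc A \<alpha> \<alpha>v))" for i j
    using class_eqI[OF km_rels.EF[where i = i and j = j]] by (auto simp: defs lie_presented_ops)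
  have inj: "H_class h = zer (contragredient sc A \<alpha> \<alpha>v) \<Longrightarrow> h = 0" for h
    using TH_injective[OF A] by (simp add: defs lie_presented_ops lie_class_eq_iff)
  interpret E: half_borel "contragredient sc A \<alpha> \<alpha>v" sc \<alpha> H_class E_class by (rule E)
  interpret F: half_borel "contragredient sc A \<alpha> \<alpha>v" sc "\<lambda>i h. - \<alpha> i h" H_class F_class by (rule F)
  \<comment> \<open>If either generator vanished, so would [e_i, f_i], which is the image of a
    nonzero coroot.\<close>
  have ne: "E_class i \<noteq> zer (contragredient sc A \<alpha> \<alpha>v)" "F_class i \<noteq> zer (contragredient sc A \<alpha> \<alpha>v)" for i
    using e_f[of i i] inj[of "\<alpha>v i"] coroot_nonzero[of i]
      L.brk_zer_left[OF F.e_closed] L.brk_zer_right[OF E.e_closed] by auto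
  show ?thesis
  proof (intro chevalley.intro borel_data.intro borel_data_axioms.intro chevalley_axioms.intro
      L.lie_algebra_axioms E F vector_space_axioms)
    fix U
    assume U: "lie_subalgebra (contragredient sc A \<alpha> \<alpha>v) U" "range H_class \<union> range E_class \<union> range F_class \<subseteq> U"
    have "lie_class R t \<in> U" for t
    proof (induction t)
      case (Gen g)
      then show ?case using U(2) by (cases g) (auto simp: defs)
    qed (use U(1) in \<open>auto simp: lie_subalgebra_def lie_subspace_def contragredient_def
        simp flip: lie_presented_ops\<close>)
    then show "carr (contragredient sc A \<alpha> \<alpha>v) \<subseteq> U"
      by (auto simp: contragredient_def lie_presented_ops)
  qed (use inj ne e_f coroot_nonzero in auto)
qed

end

theorem theorem5p1:
  fixes sc :: "'f::field_char_0 \<Rightarrow> 'h::ab_group_add \<Rightarrow> 'h"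
    and A :: "int^'i^'i::finite"
    and \<alpha> :: "'i \<Rightarrow> 'h \<Rightarrow> 'f"
    and \<alpha>v :: "'i \<Rightarrow> 'h"
  assumes "gen_cartan_matrix A"
    and "indecomposable A"
    and "realization sc A \<alpha> \<alpha>v"
  shows "is_direct_sum (Der (km_borel sc A \<alpha> \<alpha>v))
           (hom_cartan_center sc \<alpha> (kac_moody sc A \<alpha> \<alpha>v) (km_H sc A \<alpha> \<alpha>v) (km_E sc A \<alpha> \<alpha>v))
           (ad_map (km_borel sc A \<alpha> \<alpha>v) ` carr (km_borel sc A \<alpha> \<alpha>v))
       \<and> is_direct_sum (Der (contra_borel sc A \<alpha> \<alpha>v))
           (hom_cartan_center sc \<alpha> (contragredient sc A \<alpha> \<alpha>v) (contra_H sc A \<alpha> \<alpha>v) (contra_E sc A \<alpha> \<alpha>v))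
           (ad_map (contra_borel sc A \<alpha> \<alpha>v) ` carr (contra_borel sc A \<alpha> \<alpha>v))"
proof
  interpret realization sc A \<alpha> \<alpha>v by fact
  interpret C: chevalley "contragredient sc A \<alpha> \<alpha>v" sc \<alpha> H_class E_class F_class \<alpha>v
    by (rule chevalley_contragredient) fact
  \<comment> \<open>The radical is the \<open>GREATEST\<close> ideal avoiding \<open>H\<close>, so
    its quotient inherits the embedding of \<open>H\<close>, and both Borel subalgebras fall under
    \<open>borel_data\<close>.\<close>
  have "C.avoids_cartan (km_radical sc A \<alpha> \<alpha>v)"
    using C.avoids_cartan_greatest by (simp add: km_radical_def C.avoids_cartan_def[abs_def])
  from C.quotient_borel_data[OF this]
  interpret K: borel_data "kac_moody sc A \<alpha> \<alpha>v" sc \<alpha> "km_H sc A \<alpha> \<alpha>v" "km_E sc A \<alpha> \<alpha>v"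
    by (simp add: kac_moody_def km_H_def[abs_def] km_E_def[abs_def] km_proj_def)
  show "is_direct_sum (Der (km_borel sc A \<alpha> \<alpha>v))
      (hom_cartan_center sc \<alpha> (kac_moody sc A \<alpha> \<alpha>v) (km_H sc A \<alpha> \<alpha>v) (km_E sc A \<alpha> \<alpha>v))
      (ad_map (km_borel sc A \<alpha> \<alpha>v) ` carr (km_borel sc A \<alpha> \<alpha>v))"
    unfolding km_borel_def by (rule K.Der_borel)
  show "is_direct_sum (Der (contra_borel sc A \<alpha> \<alpha>v))
      (hom_cartan_center sc \<alpha> (contragredient sc A \<alpha> \<alpha>v) H_class E_class)
      (ad_map (contra_borel sc A \<alpha> \<alpha>v) ` carr (contra_borel sc A \<alpha> \<alpha>v))"
    unfolding contra_borel_def by (rule C.E.Der_borel)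
qed

end
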